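(* There exists a non-empty Zariski open subset $\Delta\subset\mathbb C^2$ (coordinates $(d,k)$) such that for every $(d_0,k_0)\in\Delta$: (1) there exist exactly $\delta_1$ solutions $\Gamma=\{(p_i,q_i,u_i)\}_{i=1,\dots,\delta_1}$ (with $p_i,q_i\in\mathbb C^2$, $u_i\in\mathbb C$) of the system $\mathfrak S_2(d_0,k_0)$ such that (a) $q_1,\dots,q_{\delta_1}$ are pairwise distinct and $\mathcal L(k_0)\cap\mathcal O_{d_0}(\mathcal C)=\{q_1,\dots,q_{\delta_1}\}$, and (b) $p_1,\dots,p_{\delta_1}$ are pairwise distinct regular non-ramification points of $\mathcal C$; (2) no point of $\mathcal C$ lying on the line $y_2=k_0$ is a ramification point of $\mathcal C$.
   Context: Standing assumptions and notation. $f(y_1,y_2)\in\mathbb C[y_1,y_2]$ is an irreducible polynomial of degree $n$ defining an affine plane curve $\mathcal C\subset\mathbb C^2$; $\mathcal C$ is not a line, and $f$ does not divide $f_1^2+f_2^2$, where $f_i=\partial f/\partial y_i$. Write $\bar y=(y_1,y_2)$, $\bar x=(x_1,x_2)$, and let $d,u$ be further variables. Put $b(\bar y,\bar x,d)=(x_1-y_1)^2+(x_2-y_2)^2-d^2$, $n(\bar y,\bar x)=-f_2(\bar y)(x_1-y_1)+f_1(\bar y)(x_2-y_2)$, $w(\bar y,u)=u(f_1^2(\bar y)+f_2^2(\bar y))-1$. Let $\Omega(d)\subset\mathbb C^6$ be the common zero set of $f,b,n,w$ in the variables $(\bar y,\bar x,d,u)$, and for $d_0\in\mathbb C\setminus\{0\}$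 let $I(d_0)=\langle f,b(\bar y,\bar x,d_0),n,w\rangle\subset\mathbb C[\bar y,\bar x,u]$ and $\Omega(d_0)\subset\mathbb C^5$ its zero set. The offset of $\mathcal C$ at distance $d_0$ is $\mathcal O_{d_0}(\mathcal C)$, the Zariski closure of the projection of $\Omega(d_0)$ to the $\bar x$-coordinates; the generic offset $\mathcal O_d(\mathcal C)\subset\mathbb C^3$ is the Zariski closure of the projection of $\Omega(d)$ to the $(\bar x,d)$-coordinates (it is a surface). The generic offset equation $g(x_1,x_2,d)\in\mathbb C[\bar x,d]$ is a square-free polynomial defining the surface $\mathcal O_d(\mathcal C)$, normalized to have no factor of positive degree lying in $\mathbb C[d]$ (it is determined up to a nonzero constant factor). Let $\delta_1=\deg_{x_1}g$. For $(d_0,k_0)\in\mathbb C^2$, $\mathcal L(k_0)$ is the line $x_2=k_0$, and $\mathfrak S_2(d_0,k_0)$ is the system $f(\bar y)=0$, $b(\bar y,\bar x,d_0)=0$, $n(\bar y,\bar x)=0$, $w(\bar y,u)=0$, $x_2-k_0=0$ in the unknowns $(\bar y,\bar x,u)\in\mathbb C^5$. A point $p\in\mathcal C$ is a ramification point if $f_2(p)=0$; it is regular if it is a nonsingular point of $\mathcal C$. *)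

theory Defs
  imports "HOL-Computational_Algebra.Computational_Algebra"
begin

text \<open>Bivariate polynomials over C are represented as complex poly poly:
  the outer variable is the second coordinate, the coefficients are polynomials
  in the first coordinate.  So p = sum_i c_i(z1) z2^i.\<close>

definition ev2 :: "complex poly poly \<Rightarrow> complex \<Rightarrow> complex \<Rightarrow> complex" where
  "ev2 p z1 z2 = poly (map_poly (\<lambda>c. poly c z1) p) z2"

definition pd1 :: "complex poly poly \<Rightarrow> complex poly poly" where
  "pd1 p = map_poly pderiv p"
definition pd2 :: "complex poly poly \<Rightarrow> complex poly poly" where
  "pd2 p = pderiv p"

text \<open>Trivariate polynomials g(x1,x2,d): outer variable x1, middle x2, inner d.\<close>
definition ev3 :: "complex poly poly poly \<Rightarrow> complex \<Rightarrow> complex \<Rightarrow> complex \<Rightarrow> complex" where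
  "ev3 g x1 x2 d = poly (map_poly (\<lambda>q. ev2 q d x2) g) x1"

definition deg_x1 :: "complex poly poly poly \<Rightarrow> nat" where
  "deg_x1 g = degree g"

definition zariski_closed2 :: "(complex \<times> complex) set \<Rightarrow> bool" where
  "zariski_closed2 S \<longleftrightarrow> (\<exists>P. S = {(a,b). \<forall>p\<in>P. ev2 p a b = 0})"
definition zariski_open2 :: "(complex \<times> complex) set \<Rightarrow> bool" where
  "zariski_open2 S \<longleftrightarrow> zariski_closed2 (- S)"
definition zclosure2 :: "(complex \<times> complex) set \<Rightarrow> (complex \<times> complex) set" where
  "zclosure2 S = \<Inter>{T. zariski_closed2 T \<and> S \<subseteq> T}"

definition zariski_closed3 :: "(complex \<times> complex \<times> complex) set \<Rightarrow> bool" where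
  "zariski_closed3 S \<longleftrightarrow> (\<exists>P. S = {(a,b,c). \<forall>p\<in>P. ev3 p a b c = 0})"
definition zclosure3 :: "(complex \<times> complex \<times> complex) set \<Rightarrow> (complex \<times> complex \<times> complex) set" where
  "zclosure3 S = \<Inter>{T. zariski_closed3 T \<and> S \<subseteq> T}"

definition bpol :: "complex \<times> complex \<Rightarrow> complex \<times> complex \<Rightarrow> complex \<Rightarrow> complex" where
  "bpol y x d = (fst x - fst y)^2 + (snd x - snd y)^2 - d^2"
definition npol :: "complex poly poly \<Rightarrow> complex \<times> complex \<Rightarrow> complex \<times> complex \<Rightarrow> complex" where
  "npol f y x = - ev2 (pd2 f) (fst y) (snd y) * (fst x - fst y) + ev2 (pd1 f) (fst y) (snd y) * (snd x - snd y)"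
definition wpol :: "complex poly poly \<Rightarrow> complex \<times> complex \<Rightarrow> complex \<Rightarrow> complex" where
  "wpol f y u = u * ((ev2 (pd1 f) (fst y) (snd y))^2 + (ev2 (pd2 f) (fst y) (snd y))^2) - 1"

definition offset_sys :: "complex poly poly \<Rightarrow> complex \<times> complex \<Rightarrow> complex \<times> complex \<Rightarrow> complex \<Rightarrow> complex \<Rightarrow> bool" where
  "offset_sys f y x u d \<longleftrightarrow> ev2 f (fst y) (snd y) = 0 \<and> bpol y x d = 0 \<and> npol f y x = 0 \<and> wpol f y u = 0"

definition curve :: "complex poly poly \<Rightarrow> (complex \<times> complex) set" where
  "curve f = {(a,b). ev2 f a b = 0}"

definition offset :: "complex poly poly \<Rightarrow> complex \<Rightarrow> (complex \<times> complex) set" where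
  "offset f d0 = zclosure2 {x. \<exists>y u. offset_sys f y x u d0}"

definition generic_offset :: "complex poly poly \<Rightarrow> (complex \<times> complex \<times> complex) set" where
  "generic_offset f = zclosure3 {(x1,x2,d). \<exists>y u. offset_sys f y (x1,x2) u d}"

definition is_generic_offset_eq :: "complex poly poly \<Rightarrow> complex poly poly poly \<Rightarrow> bool" where
  "is_generic_offset_eq f g \<longleftrightarrow> squarefree g
     \<and> {(x1,x2,d). ev3 g x1 x2 d = 0} = generic_offset f
     \<and> (\<forall>h :: complex poly. degree h > 0 \<longrightarrow> \<not> ([:[:h:]:] dvd g))"

definition sys2 :: "complex poly poly \<Rightarrow> complex \<Rightarrow> complex \<Rightarrow> complex \<times> complex \<Rightarrow> complex \<times> complex \<Rightarrow> complex \<Rightarrow> bool" where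
  "sys2 f d0 k0 y x u \<longleftrightarrow> offset_sys f y x u d0 \<and> snd x = k0"

definition line2 :: "complex \<Rightarrow> (complex \<times> complex) set" where
  "line2 k0 = {x. snd x = k0}"

definition ramification_pt :: "complex poly poly \<Rightarrow> complex \<times> complex \<Rightarrow> bool" where
  "ramification_pt f p \<longleftrightarrow> p \<in> curve f \<and> ev2 (pd2 f) (fst p) (snd p) = 0"

definition regular_pt :: "complex poly poly \<Rightarrow> complex \<times> complex \<Rightarrow> bool" where
  "regular_pt f p \<longleftrightarrow> p \<in> curve f \<and>
     (ev2 (pd1 f) (fst p) (snd p), ev2 (pd2 f) (fst p) (snd p)) \<noteq> (0, 0)"

definition is_line :: "(complex \<times> complex) set \<Rightarrow> bool" where
  "is_line S \<longleftrightarrow> (\<exists>a b c. (a, b) \<noteq> (0, 0) \<and> S = {(y1,y2). a * y1 + b * y2 + c = 0})"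

end

theory Submission
  imports Defs "HOL-Computational_Algebra.Field_as_Ring"
begin

text \<open>
  On \<open>\<Omega>(d)\<close> write \<open>x = y + d N\<close> with \<open>N\<close> a unit normal of the curve at \<open>y\<close>. Moving \<open>d\<close> along the normal line
  gives \<open>\<nabla>\<^sub>x g \<bullet> N + g\<^sub>d = 0\<close>, and moving \<open>y\<close> along the curve gives \<open>\<nabla>\<^sub>x g \<bullet> T = 0\<close> for a tangent \<open>T\<close>. Hence
  \<open>\<nabla>\<^sub>x g = - g\<^sub>d N\<close>: the tangent plane of the generic offset determines the foot point
  \<open>y = x + d \<nabla>\<^sub>x g / g\<^sub>d\<close>, so a point with \<open>g\<^sub>d \<noteq> 0\<close> has at most one generator. Conversely, the
  equations \<open>f = b = n = 0\<close> at this rational foot point hold on \<open>\<Omega>(d)\<close>, hence on the whole closure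
  \<open>g = 0\<close>. Since \<open>g\<close> is square-free, no factor of \<open>g\<close> involving \<open>x\<^sub>1\<close> divides \<open>\<partial>g/\<partial>x\<^sub>1\<close>, \<open>g\<^sub>d\<close> or
  the numerator of \<open>f\<^sub>1\<^sup>2 + f\<^sub>2\<^sup>2\<close> at the foot point, so for generic \<open>(d, k)\<close> the polynomial
  \<open>g(\<cdot>, k, d)\<close> has \<open>\<delta>\<^sub>1\<close> simple roots, each of which lifts to exactly one solution.
\<close>

subsection \<open>Evaluation as a ring homomorphism\<close>

lemma ev2_0 [simp]: "ev2 0 a b = 0"
  by (simp add: ev2_def)

lemma ev2_pCons [simp]: "ev2 (pCons p P) a b = poly p a + b * ev2 P a b"
  by (simp add: ev2_def map_poly_pCons)

lemma ev2_eq_poly: "ev2 P a b = poly (poly P [:b:]) a"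
  by (induction P) simp_all

lemma ev2_add [simp]: "ev2 (P + Q) a b = ev2 P a b + ev2 Q a b"
  and ev2_mult [simp]: "ev2 (P * Q) a b = ev2 P a b * ev2 Q a b"
  and ev2_1 [simp]: "ev2 1 a b = 1"
  and ev2_power [simp]: "ev2 (P ^ n) a b = ev2 P a b ^ n"
  by (simp_all add: ev2_eq_poly poly_power)

lemma ev2_smult [simp]: "ev2 (smult p P) a b = poly p a * ev2 P a b"
  by (simp add: ev2_eq_poly)

lemma ev3_0 [simp]: "ev3 0 x1 x2 d = 0"
  by (simp add: ev3_def)

lemma ev3_pCons [simp]: "ev3 (pCons p P) x1 x2 d = ev2 p d x2 + x1 * ev3 P x1 x2 d"
  by (simp add: ev3_def map_poly_pCons)

lemma ev3_eq_poly: "ev3 P x1 x2 d = ev2 (poly P [:[:x1:]:]) d x2"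
  by (induction P) simp_all

lemma ev3_add [simp]: "ev3 (P + Q) x1 x2 d = ev3 P x1 x2 d + ev3 Q x1 x2 d"
  and ev3_mult [simp]: "ev3 (P * Q) x1 x2 d = ev3 P x1 x2 d * ev3 Q x1 x2 d"
  and ev3_smult [simp]: "ev3 (smult p P) x1 x2 d = ev2 p d x2 * ev3 P x1 x2 d"
  and ev3_power [simp]: "ev3 (P ^ n) x1 x2 d = ev3 P x1 x2 d ^ n"
  by (simp_all add: ev3_eq_poly poly_power)

text \<open>Closure under polynomial expressions is the single principle by which every substitution below
  is recognised as a polynomial.\<close>

definition fun_algebra :: "('a \<Rightarrow> complex) set \<Rightarrow> bool" where
  "fun_algebra A \<longleftrightarrow> (\<forall>c. (\<lambda>_. c) \<in> A) \<and>
     (\<forall>u\<in>A. \<forall>v\<in>A. (\<lambda>z. u z + v z) \<in> A \<and> (\<lambda>z. u z * v z) \<in> A)"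

lemma fun_algebra_const: "fun_algebra A \<Longrightarrow> (\<lambda>_. c) \<in> A"
  and fun_algebra_add: "fun_algebra A \<Longrightarrow> u \<in> A \<Longrightarrow> v \<in> A \<Longrightarrow> (\<lambda>z. u z + v z) \<in> A"
  and fun_algebra_mult: "fun_algebra A \<Longrightarrow> u \<in> A \<Longrightarrow> v \<in> A \<Longrightarrow> (\<lambda>z. u z * v z) \<in> A"
  by (simp_all add: fun_algebra_def)

lemma fun_algebra_diff:
  assumes "fun_algebra A" "u \<in> A" "v \<in> A"
  shows "(\<lambda>z. u z - v z) \<in> A"
proof -
  have "(\<lambda>z. u z + (- 1) * v z) \<in> A"
    by (intro fun_algebra_add[OF assms(1)] fun_algebra_mult[OF assms(1)]
        fun_algebra_const[OF assms(1)] assms)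
  then show ?thesis by simp
qed

lemma fun_algebra_poly:
  assumes "fun_algebra A" "u \<in> A"
  shows "(\<lambda>z. poly p (u z)) \<in> A"
proof (induction p)
  case 0
  then show ?case using fun_algebra_const[OF assms(1), of 0] by simp
next
  case (pCons c p)
  then show ?case
    using fun_algebra_add[OF assms(1) fun_algebra_const[OF assms(1), of c]
        fun_algebra_mult[OF assms(1,2) pCons(2)]] by simp
qed

lemma fun_algebra_ev2:
  assumes "fun_algebra A" "u \<in> A" "v \<in> A"
  shows "(\<lambda>z. ev2 P (u z) (v z)) \<in> A"
proof (induction P)
  case 0
  then show ?case using fun_algebra_const[OF assms(1), of 0] by simp
next
  case (pCons p P)
  then show ?case
    using fun_algebra_add[OF assms(1) fun_algebra_poly[OF assms(1,2), of p]
        fun_algebra_mult[OF assms(1,3) pCons(2)]] by simp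
qed

lemma fun_algebra_ev3:
  assumes "fun_algebra A" "u \<in> A" "v \<in> A" "w \<in> A"
  shows "(\<lambda>z. ev3 P (u z) (v z) (w z)) \<in> A"
proof (induction P)
  case 0
  then show ?case using fun_algebra_const[OF assms(1), of 0] by simp
next
  case (pCons p P)
  then show ?case
    using fun_algebra_add[OF assms(1) fun_algebra_ev2[OF assms(1,4,3), of p]
        fun_algebra_mult[OF assms(1,2) pCons(2)]] by simp
qed

lemma fun_algebra_polynomials: "fun_algebra (range poly)"
  unfolding fun_algebra_def
proof (intro conjI ballI allI)
  fix c :: complex
  have "(\<lambda>_. c) = poly [:c:]" by auto
  then show "(\<lambda>_. c) \<in> range poly" by blast
next
  fix u v :: "complex \<Rightarrow> complex" assume "u \<in> range poly" "v \<in> range poly"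
  then obtain p q where "u = poly p" "v = poly q" by blast
  then have "(\<lambda>z. u z + v z) = poly (p + q)" "(\<lambda>z. u z * v z) = poly (p * q)" by auto
  then show "(\<lambda>z. u z + v z) \<in> range poly" "(\<lambda>z. u z * v z) \<in> range poly" by blast+
qed

definition funs2 :: "(complex \<times> complex \<Rightarrow> complex) set" where
  "funs2 = range (\<lambda>P (a, b). ev2 P a b)"

lemma fun_algebra_funs2: "fun_algebra funs2"
  unfolding fun_algebra_def
proof (intro conjI ballI allI)
  fix c :: complex
  have "(\<lambda>_. c) = (\<lambda>(a, b). ev2 [:[:c:]:] a b)" by auto
  then show "(\<lambda>_. c) \<in> funs2" unfolding funs2_def by blast
next
  fix u v assume "u \<in> funs2" "v \<in> funs2"
  then obtain p q where uv: "u = (\<lambda>(a, b). ev2 p a b)" "v = (\<lambda>(a, b). ev2 q a b)"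
    unfolding funs2_def by blast
  then have "(\<lambda>z. u z + v z) = (\<lambda>(a, b). ev2 (p + q) a b)"
    "(\<lambda>z. u z * v z) = (\<lambda>(a, b). ev2 (p * q) a b)" by auto
  then show "(\<lambda>z. u z + v z) \<in> funs2" "(\<lambda>z. u z * v z) \<in> funs2"
    unfolding funs2_def by blast+
qed

lemma fst_in_funs2: "fst \<in> funs2" and snd_in_funs2: "snd \<in> funs2"
proof -
  have "fst = (\<lambda>(a, b). ev2 [:[:0, 1:]:] a b)" "snd = (\<lambda>(a, b). ev2 [:0, 1:] a b)"
    by auto
  then show "fst \<in> funs2" "snd \<in> funs2" unfolding funs2_def by blast+
qed

lemma in_funs2E:
  assumes "F \<in> funs2" obtains P where "\<And>a b. ev2 P a b = F (a, b)"
  using assms unfolding funs2_def by auto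

text \<open>The localization of the polynomial ring at \<open>w\<close>; values at the zeros of \<open>w\<close> are junk.\<close>

definition funs3_loc :: "complex poly poly poly \<Rightarrow> (complex \<times> complex \<times> complex \<Rightarrow> complex) set" where
  "funs3_loc w = {F. \<exists>n G. \<forall>x1 x2 d. ev3 w x1 x2 d \<noteq> 0 \<longrightarrow>
     ev3 w x1 x2 d ^ n * F (x1, x2, d) = ev3 G x1 x2 d}"

lemma fun_algebra_funs3_loc: "fun_algebra (funs3_loc w)"
  unfolding fun_algebra_def
proof (intro conjI ballI allI)
  fix c :: complex
  have "\<forall>x1 x2 d. ev3 w x1 x2 d \<noteq> 0 \<longrightarrow> ev3 w x1 x2 d ^ 0 * c = ev3 [:[:[:c:]:]:] x1 x2 d"
    by simp
  then show "(\<lambda>_. c) \<in> funs3_loc w" unfolding funs3_loc_def by blast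
next
  fix u v assume "u \<in> funs3_loc w" "v \<in> funs3_loc w"
  then obtain n G m H where
    G: "\<And>x1 x2 d. ev3 w x1 x2 d \<noteq> 0 \<Longrightarrow> ev3 w x1 x2 d ^ n * u (x1, x2, d) = ev3 G x1 x2 d" and
    H: "\<And>x1 x2 d. ev3 w x1 x2 d \<noteq> 0 \<Longrightarrow> ev3 w x1 x2 d ^ m * v (x1, x2, d) = ev3 H x1 x2 d"
    unfolding funs3_loc_def by blast
  have "\<forall>x1 x2 d. ev3 w x1 x2 d \<noteq> 0 \<longrightarrow> ev3 w x1 x2 d ^ (n + m) * (u (x1, x2, d) + v (x1, x2, d))
    = ev3 (w ^ m * G + w ^ n * H) x1 x2 d"
    by (simp add: G[symmetric] H[symmetric] algebra_simps power_add)
  then show "(\<lambda>z. u z + v z) \<in> funs3_loc w" unfolding funs3_loc_def by blast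
  have "\<forall>x1 x2 d. ev3 w x1 x2 d \<noteq> 0 \<longrightarrow> ev3 w x1 x2 d ^ (n + m) * (u (x1, x2, d) * v (x1, x2, d))
    = ev3 (G * H) x1 x2 d"
    by (simp add: G[symmetric] H[symmetric] algebra_simps power_add)
  then show "(\<lambda>z. u z * v z) \<in> funs3_loc w" unfolding funs3_loc_def by blast
qed

lemma coordinates_in_funs3_loc:
  "(\<lambda>(x1, x2, d). x1) \<in> funs3_loc w" "(\<lambda>(x1, x2, d). x2) \<in> funs3_loc w"
  "(\<lambda>(x1, x2, d). d) \<in> funs3_loc w"
proof -
  show "(\<lambda>(x1, x2, d). x1) \<in> funs3_loc w"
    unfolding funs3_loc_def by (auto intro!: exI[of _ 0] exI[of _ "[:0, 1:]"])
  show "(\<lambda>(x1, x2, d). x2) \<in> funs3_loc w"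
    unfolding funs3_loc_def by (auto intro!: exI[of _ 0] exI[of _ "[:[:0, 1:]:]"])
  show "(\<lambda>(x1, x2, d). d) \<in> funs3_loc w"
    unfolding funs3_loc_def by (auto intro!: exI[of _ 0] exI[of _ "[:[:[:0, 1:]:]:]"])
qed

lemma quotient_in_funs3_loc: "(\<lambda>(x1, x2, d). ev3 G x1 x2 d / ev3 w x1 x2 d) \<in> funs3_loc w"
  unfolding funs3_loc_def by (auto intro!: exI[of _ 1] exI[of _ G])

text \<open>Along the normals of the curve, the squared distance is polynomial in the foot point and
  the normal parameter, while \<open>d\<close> itself needs a square root. The even and odd parts
  express \<open>G\<close> through \<open>d^2\<close>. The functions that split form an algebra
  containing the coordinates.\<close>

lemma ev3_even_odd:
  obtains P Q where
    "\<And>x1 x2 d. ev3 G x1 x2 d = ev3 P x1 x2 (d\<^sup>2) + d * ev3 Q x1 x2 (d\<^sup>2)"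
proof -
  define A :: "(complex \<times> complex \<times> complex \<Rightarrow> complex) set" where
    "A = {F. \<exists>P Q. \<forall>x1 x2 d. F (x1, x2, d) = ev3 P x1 x2 (d\<^sup>2) + d * ev3 Q x1 x2 (d\<^sup>2)}"
  have "fun_algebra A"
    unfolding fun_algebra_def
  proof (intro conjI ballI allI)
    fix c :: complex
    show "(\<lambda>_. c) \<in> A"
      unfolding A_def mem_Collect_eq
      by (rule exI[of _ "[:[:[:c:]:]:]"], rule exI[of _ 0]) simp
  next
    fix u v assume "u \<in> A" "v \<in> A"
    then obtain P Q P' Q' where
      u: "\<And>x1 x2 d. u (x1, x2, d) = ev3 P x1 x2 (d\<^sup>2) + d * ev3 Q x1 x2 (d\<^sup>2)" and
      v: "\<And>x1 x2 d. v (x1, x2, d) = ev3 P' x1 x2 (d\<^sup>2) + d * ev3 Q' x1 x2 (d\<^sup>2)"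
      unfolding A_def by blast
    show "(\<lambda>z. u z + v z) \<in> A"
      unfolding A_def mem_Collect_eq
      by (rule exI[of _ "P + P'"], rule exI[of _ "Q + Q'"]) (simp add: u v algebra_simps)
    \<comment> \<open>The product of two odd parts is even; \<open>[:[:[:0, 1:]:]:]\<close>,
      evaluated at \<open>d^2\<close>, supplies the factor \<open>d * d\<close>.\<close>
    show "(\<lambda>z. u z * v z) \<in> A"
      unfolding A_def mem_Collect_eq
      by (rule exI[of _ "P * P' + [:[:[:0, 1:]:]:] * (Q * Q')"], rule exI[of _ "P * Q' + Q * P'"])
        (simp add: u v algebra_simps power2_eq_square)
  qed
  moreover have "(\<lambda>(x1, x2, d). x1) \<in> A"
    unfolding A_def mem_Collect_eq by (rule exI[of _ "[:0, 1:]"], rule exI[of _ 0]) simp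
  moreover have "(\<lambda>(x1, x2, d). x2) \<in> A"
    unfolding A_def mem_Collect_eq by (rule exI[of _ "[:[:0, 1:]:]"], rule exI[of _ 0]) simp
  moreover have "(\<lambda>(x1, x2, d). d) \<in> A"
    unfolding A_def mem_Collect_eq by (rule exI[of _ 0], rule exI[of _ 1]) (simp add: one_pCons)
  ultimately have "(\<lambda>z. ev3 G ((\<lambda>(x1, x2, d). x1) z) ((\<lambda>(x1, x2, d). x2) z)
      ((\<lambda>(x1, x2, d). d) z)) \<in> A"
    by (rule fun_algebra_ev3)
  then show thesis unfolding A_def using that by auto
qed

text \<open>Fixing \<open>d\<close> removes the innermost variable of \<open>G\<close> and makes x1
  innermost; closure of \<open>funs2\<close> under substitution avoids rearranging
  coefficients.\<close>

lemma ev3_slice: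
  obtains P where "\<And>x1 x2. ev2 P x1 x2 = ev3 G x1 x2 d"
  using in_funs2E[OF fun_algebra_ev3[OF fun_algebra_funs2 fst_in_funs2 snd_in_funs2
      fun_algebra_const[OF fun_algebra_funs2, of d], of G]] by auto

subsection \<open>Derivatives along curves\<close>

lemma pd1_pCons [simp]: "pd1 (pCons p P) = pCons (pderiv p) (pd1 P)"
  by (simp add: pd1_def map_poly_pCons)

lemma pd1_0 [simp]: "pd1 0 = 0" and pd2_0 [simp]: "pd2 0 = 0"
  by (simp_all add: pd1_def pd2_def)

lemma ev2_pd2_pCons [simp]: "ev2 (pd2 (pCons p P)) a b = ev2 P a b + b * ev2 (pd2 P) a b"
  by (simp add: pd2_def pderiv_pCons)

lemma has_field_derivative_ev2:
  assumes "(u has_field_derivative u') (at t)" "(v has_field_derivative v') (at t)"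
  shows "((\<lambda>t. ev2 P (u t) (v t)) has_field_derivative
    ev2 (pd1 P) (u t) (v t) * u' + ev2 (pd2 P) (u t) (v t) * v') (at t)"
proof (induction P)
  case (pCons p P)
  have "((\<lambda>t. poly p (u t) + v t * ev2 P (u t) (v t)) has_field_derivative
    poly (pderiv p) (u t) * u' + (v' * ev2 P (u t) (v t) +
      (ev2 (pd1 P) (u t) (v t) * u' + ev2 (pd2 P) (u t) (v t) * v') * v t)) (at t)"
    by (intro DERIV_add DERIV_mult assms pCons(2) DERIV_chain2[OF poly_DERIV])
  then show ?case by (simp add: algebra_simps)
qed simp

text \<open>A coefficient \<open>q\<close> is evaluated as \<open>ev2 q d x2\<close>, so
  \<open>map_poly pd2\<close> is the partial derivative in x2 and \<open>map_poly pd1\<close> the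
  one in \<open>d\<close>.\<close>

lemma has_field_derivative_ev3:
  assumes "(u has_field_derivative u') (at t)" "(v has_field_derivative v') (at t)"
    "(w has_field_derivative w') (at t)"
  shows "((\<lambda>t. ev3 P (u t) (v t) (w t)) has_field_derivative
    ev3 (pderiv P) (u t) (v t) (w t) * u' + ev3 (map_poly pd2 P) (u t) (v t) (w t) * v'
    + ev3 (map_poly pd1 P) (u t) (v t) (w t) * w') (at t)"
proof (induction P)
  case (pCons p P)
  have "((\<lambda>t. ev2 p (w t) (v t) + u t * ev3 P (u t) (v t) (w t)) has_field_derivative
    (ev2 (pd1 p) (w t) (v t) * w' + ev2 (pd2 p) (w t) (v t) * v') +
    (u' * ev3 P (u t) (v t) (w t) +
      (ev3 (pderiv P) (u t) (v t) (w t) * u' + ev3 (map_poly pd2 P) (u t) (v t) (w t) * v'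
    + ev3 (map_poly pd1 P) (u t) (v t) (w t) * w') * u t)) (at t)"
    by (intro DERIV_add DERIV_mult assms pCons(2) has_field_derivative_ev2)
  then show ?case by (simp add: algebra_simps map_poly_pCons pderiv_pCons)
qed simp

subsection \<open>Elimination\<close>

text \<open>A product of primes of degree 0 is constant, so some prime factor must carry the
  degree.\<close>

lemma prime_elem_dvd_positive_degree:
  fixes D :: "'a::{factorial_ring_gcd,semiring_gcd_mult_normalize} poly"
  assumes "degree D > 0"
  obtains p where "prime_elem p" "p dvd D" "degree p > 0"
proof -
  have D0: "D \<noteq> 0" using assms by auto
  from prime_factorization_exists[OF this]
  obtain A where A: "\<forall>p. p \<in># A \<longrightarrow> prime_elem p" "normalize (prod_mset A) = normalize D"
    by blast
  have "\<exists>p\<in>#A. degree p > 0"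
  proof (rule ccontr)
    assume *: "\<not> ?thesis"
    have "0 \<notin># A" using A(1) by force
    have "degree (prod_mset A) = 0" using *
    proof (induction A)
      case (add p A)
      then show ?case using degree_mult_le[of p "prod_mset A"] by auto
    qed simp
    moreover have "D dvd prod_mset A" using A(2) by (simp add: associated_iff_dvd)
    moreover have "prod_mset A \<noteq> 0" using \<open>0 \<notin># A\<close> by (simp add: prod_mset_zero_iff)
    ultimately show False using assms dvd_imp_degree_le[of D "prod_mset A"] by linarith
  qed
  then obtain p where p: "p \<in># A" "degree p > 0" by blast
  have "prod_mset A dvd D" using A(2) by (simp add: associated_iff_dvd)
  with p(1) have "p dvd D" using dvd_prod_mset dvd_trans by blast
  moreover have "prime_elem p" using p(1) A(1) by simp
  ultimately show thesis using p(2) that by simp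
qed

text \<open>The coefficients form no field, so Euclid's algorithm is replaced by an element
  \<open>D\<close> of least degree in the ideal of \<open>P\<close> and \<open>Q\<close>: by
  pseudo-division it divides a nonzero constant multiple of every element. A prime factor of
  \<open>D\<close> of positive degree would divide both \<open>P\<close> and \<open>Q\<close>, so
  \<open>D\<close> is a constant: the outer variable is eliminated.\<close>

lemma poly_bezout:
  fixes P Q :: "'a::{factorial_ring_gcd,semiring_gcd_mult_normalize} poly"
  assumes "P \<noteq> 0"
    and coprime: "\<And>p. prime_elem p \<Longrightarrow> degree p > 0 \<Longrightarrow> p dvd P \<Longrightarrow> \<not> p dvd Q"
  obtains A B R where "R \<noteq> 0" "A * P + B * Q = [:R:]"
proof -
  define I where "I = {D. D \<noteq> 0 \<and> (\<exists>A B. D = A * P + B * Q)}"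
  have "P = 1 * P + 0 * Q" by simp
  then have "P \<in> I" using assms(1) unfolding I_def by blast
  then obtain D where D: "D \<in> I" and min: "\<And>E. E \<in> I \<Longrightarrow> degree D \<le> degree E"
    using arg_min_nat_lemma[of "\<lambda>D. D \<in> I" P degree] by blast
  from D obtain A B where D0: "D \<noteq> 0" and AB: "D = A * P + B * Q" unfolding I_def by blast
  have dvd: "\<exists>c. c \<noteq> 0 \<and> D dvd [:c:] * (X * P + Y * Q)" for X Y
  proof -
    obtain c q where c: "c \<noteq> 0" and
      eq: "smult c (X * P + Y * Q) = D * q + pseudo_mod (X * P + Y * Q) D"
      using pseudo_mod(1)[OF D0] by blast
    define r where "r = pseudo_mod (X * P + Y * Q) D"
    have "r = 0"
    proof (rule ccontr)
      assume "r \<noteq> 0"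
      moreover have "r = ([:c:] * X - q * A) * P + ([:c:] * Y - q * B) * Q"
      proof -
        have "r = [:c:] * (X * P + Y * Q) - D * q" using eq unfolding r_def[symmetric] by simp
        then show ?thesis unfolding AB by (simp only: algebra_simps)
      qed
      ultimately have "r \<in> I" unfolding I_def by blast
      then have "degree D \<le> degree r" by (rule min)
      moreover have "degree r < degree D"
        using pseudo_mod(2)[OF D0] \<open>r \<noteq> 0\<close> unfolding r_def by blast
      ultimately show False by simp
    qed
    then have "[:c:] * (X * P + Y * Q) = D * q" using eq unfolding r_def by simp
    then show ?thesis using c by (metis dvd_triv_left)
  qed
  have "degree D = 0"
  proof (rule ccontr)
    assume "degree D \<noteq> 0"
    then obtain p where p: "prime_elem p" "p dvd D" "degree p > 0"
      using prime_elem_dvd_positive_degree by blast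
    \<comment> \<open>The constant \<open>c\<close> from pseudo-division is harmless: a prime of
      positive degree cannot divide it.\<close>
    have "p dvd F" if "c \<noteq> 0" "D dvd [:c:] * F" for c F
    proof -
      have "\<not> p dvd [:c:]" using that(1) p(3) dvd_imp_degree_le[of p "[:c:]"] by auto
      then show ?thesis using p(1,2) that(2) prime_elem_dvd_multD dvd_trans by blast
    qed
    then have "p dvd P" "p dvd Q" using dvd[of 1 0] dvd[of 0 1] by auto
    then show False using coprime p by blast
  qed
  then obtain R where "D = [:R:]" using degree_eq_zeroE by blast
  with D0 AB have "R \<noteq> 0" "A * P + B * Q = [:R:]" by auto
  then show thesis by (rule that)
qed

lemma prime_elem_bezout:
  fixes p Q :: "'a::{factorial_ring_gcd,semiring_gcd_mult_normalize} poly"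
  assumes "prime_elem p" "\<not> p dvd Q"
  obtains A B R where "R \<noteq> 0" "A * p + B * Q = [:R:]"
proof (rule poly_bezout[of p Q])
  show "p \<noteq> 0" using assms by auto
  fix q assume q: "prime_elem q" "degree q > 0" "q dvd p"
  then have "p dvd q" using assms(1) by (meson irreducibleD' prime_elem_def prime_elem_imp_irreducible)
  then show "\<not> q dvd Q" using assms(2) dvd_trans by blast
qed (use that in blast)

section \<open>Zero sets and divisibility\<close>

lemma ev2_neq_0:
  assumes "R \<noteq> 0"
  obtains a b where "ev2 R a b \<noteq> 0"
proof -
  have nz: "\<exists>z. poly p z \<noteq> 0" if "p \<noteq> 0" for p :: "complex poly"
    using that poly_all_0_iff_0 by blast
  obtain a where a: "poly (lead_coeff R) a \<noteq> 0" using nz assms by (meson leading_coeff_0_iff)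
  have "coeff (map_poly (\<lambda>c. poly c a) R) (degree R) \<noteq> 0" using a by (simp add: coeff_map_poly)
  then have "map_poly (\<lambda>c. poly c a) R \<noteq> 0" by force
  from nz[OF this] show thesis using that unfolding ev2_def by blast
qed

text \<open>A Nullstellensatz for one prime. If \<open>p\<close> did not divide \<open>Q\<close>,
  elimination would give a nonzero \<open>R\<close> in the inner variable alone; over a point where
  neither \<open>R\<close> nor the leading coefficient of \<open>p\<close> vanishes,
  \<open>p\<close> still has a zero, and there \<open>R\<close> would have to vanish.\<close>

lemma ev2_prime_elem_dvd:
  assumes "prime_elem p" "degree p > 0"
    and zeros: "\<And>a b. ev2 p a b = 0 \<Longrightarrow> ev2 Q a b = 0"
  shows "p dvd Q"
proof (rule ccontr)
  assume "\<not> p dvd Q"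
  then obtain A B R where R: "R \<noteq> 0" and eq: "A * p + B * Q = [:R:]"
    by (rule prime_elem_bezout[OF assms(1)])
  have "R * lead_coeff p \<noteq> 0" using R assms(2) by auto
  then obtain a where a: "poly R a \<noteq> 0" "poly (lead_coeff p) a \<noteq> 0"
    using poly_all_0_iff_0[of "R * lead_coeff p"] by auto
  have "coeff (map_poly (\<lambda>c. poly c a) p) (degree p) \<noteq> 0" using a by (simp add: coeff_map_poly)
  then have "degree (map_poly (\<lambda>c. poly c a) p) \<noteq> 0" using assms(2) le_degree by fastforce
  then have "\<not> constant (poly (map_poly (\<lambda>c. poly c a) p))" by (simp add: constant_degree)
  then obtain b where "ev2 p a b = 0"
    unfolding ev2_def using fundamental_theorem_of_algebra by blast
  with zeros[OF this] a(1) arg_cong[OF eq, of "\<lambda>F. ev2 F a b"] show False by simp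
qed

lemma degree_slice3:
  assumes "ev2 (lead_coeff p) d x2 \<noteq> 0"
  shows "degree (map_poly (\<lambda>q. ev2 q d x2) p) = degree p"
proof (rule antisym)
  show "degree (map_poly (\<lambda>q. ev2 q d x2) p) \<le> degree p" by (intro degree_le) (auto simp: coeff_map_poly coeff_eq_0)
  show "degree p \<le> degree (map_poly (\<lambda>q. ev2 q d x2) p)"
    using assms by (intro le_degree) (simp add: coeff_map_poly)
qed

lemma ev3_prime_elem_dvd:
  assumes "prime_elem p" "degree p > 0"
    and zeros: "\<And>x1 x2 d. ev3 p x1 x2 d = 0 \<Longrightarrow> ev3 Q x1 x2 d = 0"
  shows "p dvd Q"
proof (rule ccontr)
  assume "\<not> p dvd Q"
  then obtain A B R where R: "R \<noteq> 0" and eq: "A * p + B * Q = [:R:]"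
    by (rule prime_elem_bezout[OF assms(1)])
  have "R * lead_coeff p \<noteq> 0" using R assms(2) by auto
  then obtain d x2 where "ev2 (R * lead_coeff p) d x2 \<noteq> 0" by (rule ev2_neq_0)
  then have a: "ev2 R d x2 \<noteq> 0" "ev2 (lead_coeff p) d x2 \<noteq> 0" by auto
  then have "\<not> constant (poly (map_poly (\<lambda>q. ev2 q d x2) p))"
    using assms(2) by (simp add: constant_degree degree_slice3)
  then obtain x1 where "ev3 p x1 x2 d = 0"
    unfolding ev3_def using fundamental_theorem_of_algebra by blast
  with zeros[OF this] a(1) arg_cong[OF eq, of "\<lambda>F. ev3 F x1 x2 d"] show False by simp
qed

text \<open>The source of every genericity condition on \<open>(d, k)\<close> that concerns
  \<open>g\<close>: \<open>R\<close> plays the role of a resultant with respect to x1.\<close>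

lemma ev3_no_common_root:
  assumes "P \<noteq> 0"
    and "\<And>p. prime_elem p \<Longrightarrow> degree p > 0 \<Longrightarrow> p dvd P \<Longrightarrow> \<not> p dvd Q"
  obtains R where "R \<noteq> 0"
    "\<And>x1 x2 d. ev2 R d x2 \<noteq> 0 \<Longrightarrow> ev3 P x1 x2 d = 0 \<Longrightarrow> ev3 Q x1 x2 d \<noteq> 0"
proof -
  obtain A B R where R: "R \<noteq> 0" and eq: "A * P + B * Q = [:R:]"
    by (rule poly_bezout[OF assms])
  have "ev3 Q x1 x2 d \<noteq> 0" if "ev2 R d x2 \<noteq> 0" "ev3 P x1 x2 d = 0" for x1 x2 d
    using arg_cong[OF eq, of "\<lambda>F. ev3 F x1 x2 d"] that by auto
  then show thesis using that R by blast
qed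

subsection \<open>The gradient on the generic offset\<close>

definition grad_sq :: "complex poly poly \<Rightarrow> complex \<Rightarrow> complex \<Rightarrow> complex" where
  "grad_sq f a b = (ev2 (pd1 f) a b)\<^sup>2 + (ev2 (pd2 f) a b)\<^sup>2"

lemma offset_sysI:
  assumes "ev2 f a b = 0" "grad_sq f a b \<noteq> 0" "d\<^sup>2 = c\<^sup>2 * grad_sq f a b"
  shows "offset_sys f (a, b) (a + c * ev2 (pd1 f) a b, b + c * ev2 (pd2 f) a b)
    (1 / grad_sq f a b) d"
  using assms
  by (auto simp: offset_sys_def bpol_def npol_def wpol_def grad_sq_def algebra_simps power2_eq_square)

lemma offset_sys_grad_sq:
  assumes "offset_sys f (a, b) x u d"
  shows "grad_sq f a b \<noteq> 0" "u = 1 / grad_sq f a b"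
proof -
  have "u * grad_sq f a b = 1"
    using assms by (simp add: offset_sys_def wpol_def grad_sq_def)
  then show "grad_sq f a b \<noteq> 0" "u = 1 / grad_sq f a b"
    by (auto simp: eq_divide_eq)
qed

text \<open>The equation n makes x - y parallel to the gradient, with factor \<open>c\<close> found
  by projection, and b turns into \<open>c^2 * h = d^2\<close>. Hence \<open>s = c / d\<close>
  scales the gradient to a unit normal.\<close>

lemma offset_sysE:
  assumes "offset_sys f (a, b) (x1, x2) u d"
  obtains s where "s\<^sup>2 * grad_sq f a b = 1"
    "x1 = a + d * s * ev2 (pd1 f) a b" "x2 = b + d * s * ev2 (pd2 f) a b"
proof -
  define f1 f2 h where "f1 = ev2 (pd1 f) a b" and "f2 = ev2 (pd2 f) a b" and "h = grad_sq f a b"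
  have h: "h = f1 * f1 + f2 * f2" unfolding h_def f1_def f2_def grad_sq_def
    by (simp add: power2_eq_square)
  have h0: "h \<noteq> 0" using offset_sys_grad_sq[OF assms] by (simp add: h_def)
  have n: "f1 * (x2 - b) = f2 * (x1 - a)" and dd: "(x1 - a)\<^sup>2 + (x2 - b)\<^sup>2 = d\<^sup>2"
    using assms by (auto simp: offset_sys_def npol_def bpol_def f1_def f2_def)
  define c where "c = ((x1 - a) * f1 + (x2 - b) * f2) / h"
  have ch: "c * h = (x1 - a) * f1 + (x2 - b) * f2" using h0 by (simp add: c_def)
  have "h * (c * f1) = (c * h) * f1" by simp
  also have "\<dots> = f1 * ((x1 - a) * f1) + f2 * (f1 * (x2 - b))"
    unfolding ch by (simp add: algebra_simps)
  also have "\<dots> = h * (x1 - a)" unfolding n h by (simp add: algebra_simps)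
  finally have x1: "x1 = a + c * f1" using h0 by simp
  have "h * (c * f2) = (c * h) * f2" by simp
  also have "\<dots> = f1 * (f2 * (x1 - a)) + f2 * ((x2 - b) * f2)"
    unfolding ch by (simp add: algebra_simps)
  also have "\<dots> = h * (x2 - b)" unfolding n[symmetric] h by (simp add: algebra_simps)
  finally have x2: "x2 = b + c * f2" using h0 by simp
  have cd: "c\<^sup>2 * h = d\<^sup>2" using dd unfolding x1 x2 h by (simp add: algebra_simps power2_eq_square)
  show thesis
  proof (cases "d = 0")
    \<comment> \<open>For \<open>d = 0\<close> the quotient \<open>c / d\<close> is lost, but
      \<open>c = 0\<close> and either unit normal will do.\<close>
    case True
    then have "c = 0" using cd h0 by simp
    moreover have "(csqrt (1 / h))\<^sup>2 * h = 1" using h0 by simp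
    ultimately show thesis
      using that[of "csqrt (1 / h)"] True x1 x2 unfolding h_def by simp
  next
    case False
    have "(c / d)\<^sup>2 * h = 1" using cd False by (simp add: power_divide)
    then show thesis using that[of "c / d"] False x1 x2 unfolding h_def f1_def f2_def by simp
  qed
qed

text \<open>\<open>P\<close> times the squared gradient vanishes on the whole curve, so
  \<open>f\<close> divides \<open>P\<close>. At a zero of \<open>f\<close> the derivative of
  \<open>f * e\<close> along the tangent direction \<open>(- f2, f1)\<close> is 0, because
  \<open>f\<close> and its derivative in that direction both vanish; the tangent line can thus stand
  in for the curve.\<close>

lemma curve_tangent_derivative:
  assumes f: "prime_elem f" "degree f > 0" "\<not> f dvd pd1 f ^ 2 + pd2 f ^ 2"
    and P: "\<And>a b. ev2 f a b = 0 \<Longrightarrow> grad_sq f a b \<noteq> 0 \<Longrightarrow> ev2 P a b = 0"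
    and ab: "ev2 f a b = 0"
  shows "ev2 (pd2 P) a b * ev2 (pd1 f) a b = ev2 (pd1 P) a b * ev2 (pd2 f) a b"
proof -
  have "f dvd P * (pd1 f ^ 2 + pd2 f ^ 2)"
  proof (rule ev2_prime_elem_dvd[OF f(1,2)])
    fix a b assume "ev2 f a b = 0"
    then show "ev2 (P * (pd1 f ^ 2 + pd2 f ^ 2)) a b = 0"
      using P[of a b] by (cases "grad_sq f a b = 0") (auto simp: grad_sq_def)
  qed
  then obtain e where e: "P = f * e" using f(1,3) by (auto simp: prime_elem_dvd_mult_iff elim: dvdE)
  define f1 f2 where "f1 = ev2 (pd1 f) a b" and "f2 = ev2 (pd2 f) a b"
  have line: "((\<lambda>t. a - t * f2) has_field_derivative - f2) (at 0)"
    "((\<lambda>t. b + t * f1) has_field_derivative f1) (at 0)"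
    by (auto intro!: derivative_eq_intros)
  have "((\<lambda>t. ev2 f (a - t * f2) (b + t * f1) * ev2 e (a - t * f2) (b + t * f1))
    has_field_derivative 0) (at 0)"
    using DERIV_mult[OF has_field_derivative_ev2[OF line, of f] has_field_derivative_ev2[OF line, of e]]
    by (simp add: ab f1_def f2_def)
  moreover have "((\<lambda>t. ev2 P (a - t * f2) (b + t * f1)) has_field_derivative
    ev2 (pd1 P) a b * (- f2) + ev2 (pd2 P) a b * f1) (at 0)"
    using has_field_derivative_ev2[OF line, of P] by simp
  ultimately have "ev2 (pd1 P) a b * (- f2) + ev2 (pd2 P) a b * f1 = 0"
    unfolding e using DERIV_unique by fastforce
  then show ?thesis by (simp add: f1_def f2_def algebra_simps)
qed

lemma ev3_along_normal_poly:
  obtains p where "\<And>c. poly p c = ev3 Q (a + c * r) (b + c * s) (c\<^sup>2 * h)"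
proof -
  have id: "(\<lambda>c::complex. c) \<in> range poly"
  proof -
    have "(\<lambda>c::complex. c) = poly [:0, 1:]" by auto
    then show ?thesis by (rule range_eqI)
  qed
  note A = fun_algebra_polynomials
  have "(\<lambda>c. ev3 Q (a + c * r) (b + c * s) (c * c * h)) \<in> range poly"
    by (intro fun_algebra_ev3[OF A] fun_algebra_add[OF A] fun_algebra_mult[OF A]
        fun_algebra_const[OF A] id)
  then obtain p where "(\<lambda>c. ev3 Q (a + c * r) (b + c * s) (c * c * h)) = poly p" by blast
  then show thesis using that[of p] by (simp add: fun_eq_iff power2_eq_square)
qed

text \<open>The point \<open>(x, e) = (y + c \<nabla>f(y), c\<^sup>2 |\<nabla>f(y)|\<^sup>2)\<close> has \<open>e\<close> equal to the squared distance, which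
  keeps the family polynomial in \<open>y\<close> and \<open>c\<close>. Differentiating it along the curve and along the
  normal shows that the \<open>x\<close>-gradient is normal, up to a factor linear in \<open>c\<close> that vanishes on the
  evolute and is cancelled as a polynomial.\<close>

lemma squared_offset_gradient_normal:
  assumes f: "prime_elem f" "degree f > 0" "\<not> f dvd pd1 f ^ 2 + pd2 f ^ 2"
    and Q: "\<And>a b c. ev2 f a b = 0 \<Longrightarrow> grad_sq f a b \<noteq> 0 \<Longrightarrow>
      ev3 Q (a + c * ev2 (pd1 f) a b) (b + c * ev2 (pd2 f) a b) (c\<^sup>2 * grad_sq f a b) = 0"
    and ab: "ev2 f a b = 0" "grad_sq f a b \<noteq> 0"
  shows "ev2 (pd1 f) a b * ev3 (map_poly pd2 Q)
        (a + c * ev2 (pd1 f) a b) (b + c * ev2 (pd2 f) a b) (c\<^sup>2 * grad_sq f a b)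
    = ev2 (pd2 f) a b * ev3 (pderiv Q)
        (a + c * ev2 (pd1 f) a b) (b + c * ev2 (pd2 f) a b) (c\<^sup>2 * grad_sq f a b)"
proof -
  define f1 f2 h where "f1 = ev2 (pd1 f) a b" and "f2 = ev2 (pd2 f) a b" and "h = grad_sq f a b"
  have h: "h = f1 * f1 + f2 * f2" unfolding h_def f1_def f2_def grad_sq_def
    by (simp add: power2_eq_square)
  \<comment> \<open>Derivatives of \<open>f1\<close> and \<open>f2\<close> in the tangent direction
    \<open>(- f2, f1)\<close>.\<close>
  define f1' f2' where
    "f1' = ev2 (pd1 (pd1 f)) a b * (- f2) + ev2 (pd2 (pd1 f)) a b * f1" and
    "f2' = ev2 (pd1 (pd2 f)) a b * (- f2) + ev2 (pd2 (pd2 f)) a b * f1"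
  define Q1 Q2 Q3 where
    "Q1 = (\<lambda>c. ev3 (pderiv Q) (a + c * f1) (b + c * f2) (c\<^sup>2 * h))" and
    "Q2 = (\<lambda>c. ev3 (map_poly pd2 Q) (a + c * f1) (b + c * f2) (c\<^sup>2 * h))" and
    "Q3 = (\<lambda>c. ev3 (map_poly pd1 Q) (a + c * f1) (b + c * f2) (c\<^sup>2 * h))"
  have along_curve: "Q1 c * (- f2 + c * f1') + Q2 c * (f1 + c * f2') +
    Q3 c * (c\<^sup>2 * (2 * f1 * f1' + 2 * f2 * f2')) = 0" for c
  proof -
    note A = fun_algebra_funs2
    have "(\<lambda>y. ev3 Q (fst y + c * ev2 (pd1 f) (fst y) (snd y))
        (snd y + c * ev2 (pd2 f) (fst y) (snd y))
        (c * c * (ev2 (pd1 f) (fst y) (snd y) * ev2 (pd1 f) (fst y) (snd y) +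
          ev2 (pd2 f) (fst y) (snd y) * ev2 (pd2 f) (fst y) (snd y)))) \<in> funs2"
      by (intro fun_algebra_ev3[OF A] fun_algebra_ev2[OF A] fun_algebra_add[OF A]
          fun_algebra_mult[OF A] fun_algebra_const[OF A] fst_in_funs2 snd_in_funs2)
    from in_funs2E[OF this] obtain P where P: "\<And>a b. ev2 P a b = ev3 Q (a + c * ev2 (pd1 f) a b)
        (b + c * ev2 (pd2 f) a b) (c\<^sup>2 * grad_sq f a b)"
      unfolding grad_sq_def power2_eq_square by auto
    have line: "((\<lambda>t. a - t * f2) has_field_derivative - f2) (at 0)"
      "((\<lambda>t. b + t * f1) has_field_derivative f1) (at 0)"
      by (auto intro!: derivative_eq_intros)
    have d1: "((\<lambda>t. ev2 (pd1 f) (a - t * f2) (b + t * f1)) has_field_derivative f1') (at 0)"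
      using has_field_derivative_ev2[OF line, of "pd1 f"] by (simp add: f1'_def)
    have d2: "((\<lambda>t. ev2 (pd2 f) (a - t * f2) (b + t * f1)) has_field_derivative f2') (at 0)"
      using has_field_derivative_ev2[OF line, of "pd2 f"] by (simp add: f2'_def)
    have u: "((\<lambda>t. a - t * f2 + c * ev2 (pd1 f) (a - t * f2) (b + t * f1))
        has_field_derivative - f2 + c * f1') (at 0)"
      using DERIV_add[OF line(1) DERIV_cmult[OF d1, of c]] .
    have v: "((\<lambda>t. b + t * f1 + c * ev2 (pd2 f) (a - t * f2) (b + t * f1))
        has_field_derivative f1 + c * f2') (at 0)"
      using DERIV_add[OF line(2) DERIV_cmult[OF d2, of c]] .
    have w: "((\<lambda>t. c\<^sup>2 * grad_sq f (a - t * f2) (b + t * f1))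
        has_field_derivative c\<^sup>2 * (2 * f1 * f1' + 2 * f2 * f2')) (at 0)"
      unfolding grad_sq_def
      by (rule derivative_eq_intros d1 d2 refl)+ (simp add: f1_def f2_def)
    have "((\<lambda>t. ev2 P (a - t * f2) (b + t * f1)) has_field_derivative
        Q1 c * (- f2 + c * f1') + Q2 c * (f1 + c * f2') +
        Q3 c * (c\<^sup>2 * (2 * f1 * f1' + 2 * f2 * f2'))) (at 0)"
      unfolding P using has_field_derivative_ev3[OF u v w, of Q]
      by (simp add: Q1_def Q2_def Q3_def f1_def f2_def h_def)
    moreover have "((\<lambda>t. ev2 P (a - t * f2) (b + t * f1)) has_field_derivative
        ev2 (pd1 P) a b * (- f2) + ev2 (pd2 P) a b * f1) (at 0)"
      using has_field_derivative_ev2[OF line, of P] by simp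
    moreover have "ev2 (pd1 P) a b * (- f2) + ev2 (pd2 P) a b * f1 = 0"
      using curve_tangent_derivative[OF f, of P a b] Q ab(1)
      by (simp add: P f1_def f2_def algebra_simps)
    ultimately show ?thesis using DERIV_unique by fastforce
  qed
  have along_normal: "Q1 c * f1 + Q2 c * f2 + Q3 c * (2 * c * h) = 0" for c
  proof -
    have u: "((\<lambda>c. a + c * f1) has_field_derivative f1) (at c)"
      by (auto intro!: derivative_eq_intros)
    have v: "((\<lambda>c. b + c * f2) has_field_derivative f2) (at c)"
      by (auto intro!: derivative_eq_intros)
    have w: "((\<lambda>c. c\<^sup>2 * h) has_field_derivative 2 * c * h) (at c)"
      by (auto intro!: derivative_eq_intros)
    have "((\<lambda>c. ev3 Q (a + c * f1) (b + c * f2) (c\<^sup>2 * h)) has_field_derivative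
        Q1 c * f1 + Q2 c * f2 + Q3 c * (2 * c * h)) (at c)"
      using has_field_derivative_ev3[OF u v w, of Q] by (simp add: Q1_def Q2_def Q3_def)
    moreover have "(\<lambda>c. ev3 Q (a + c * f1) (b + c * f2) (c\<^sup>2 * h)) = (\<lambda>_. 0)"
      using Q[OF ab] by (simp add: f1_def f2_def h_def)
    ultimately show ?thesis using DERIV_unique[OF _ DERIV_const] by fastforce
  qed
  define B where "B = f1 * f2' - f2 * f1'"
  \<comment> \<open>The multipliers \<open>h\<close> and \<open>c * (f1 * f1' + f2 * f2')\<close>
    are chosen so that the terms with \<open>Q3\<close> cancel between the two relations.\<close>
  have prod: "(f1 * Q2 c - f2 * Q1 c) * (h + c * B) = 0" for c
  proof -
    have "(f1 * Q2 c - f2 * Q1 c) * (h + c * B) =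
      h * (Q1 c * (- f2 + c * f1') + Q2 c * (f1 + c * f2') +
        Q3 c * (c\<^sup>2 * (2 * f1 * f1' + 2 * f2 * f2')))
      - c * (f1 * f1' + f2 * f2') * (Q1 c * f1 + Q2 c * f2 + Q3 c * (2 * c * h))"
      unfolding h B_def by (simp add: algebra_simps power2_eq_square)
    then show ?thesis unfolding along_curve along_normal by simp
  qed
  obtain p1 where p1: "\<And>c. poly p1 c = Q1 c"
    unfolding Q1_def using ev3_along_normal_poly by blast
  obtain p2 where p2: "\<And>c. poly p2 c = Q2 c"
    unfolding Q2_def using ev3_along_normal_poly by blast
  have "poly ((smult f1 p2 - smult f2 p1) * [:h, B:]) c = 0" for c
    using prod[of c] by (simp only: poly_mult poly_diff poly_smult p1 p2) simp
  then have "(smult f1 p2 - smult f2 p1) * [:h, B:] = 0" using poly_all_0_iff_0 by blast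
  moreover have "[:h, B:] \<noteq> 0" using ab(2) by (simp add: h_def)
  ultimately have "smult f1 p2 - smult f2 p1 = 0" using mult_eq_0_iff by blast
  then have "poly (smult f1 p2 - smult f2 p1) c = 0" by simp
  then show ?thesis by (simp add: p1 p2 Q1_def Q2_def f1_def f2_def h_def)
qed

definition vanishes_on_offset :: "complex poly poly \<Rightarrow> complex poly poly poly \<Rightarrow> bool" where
  "vanishes_on_offset f G \<longleftrightarrow>
     (\<forall>a b x1 x2 u d. offset_sys f (a, b) (x1, x2) u d \<longrightarrow> ev3 G x1 x2 d = 0)"

text \<open>The same point lies on the offset at distance \<open>d\<close> and at
  \<open>- d\<close>, so the even and the odd part of \<open>G\<close> vanish separately on the
  squared family. Each then has a normal x-gradient, and so has their combination
  \<open>G\<close>.\<close>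

lemma offset_gradient_normal:
  assumes f: "prime_elem f" "degree f > 0" "\<not> f dvd pd1 f ^ 2 + pd2 f ^ 2"
    and G: "vanishes_on_offset f G"
    and sys: "offset_sys f (a, b) (x1, x2) u d"
  shows "ev2 (pd1 f) a b * ev3 (map_poly pd2 G) x1 x2 d
    = ev2 (pd2 f) a b * ev3 (pderiv G) x1 x2 d"
proof -
  obtain P Q where PQ: "\<And>x1 x2 d. ev3 G x1 x2 d = ev3 P x1 x2 (d\<^sup>2) + d * ev3 Q x1 x2 (d\<^sup>2)"
    using ev3_even_odd[of G] by blast
  have zero: "ev3 P (a + c * ev2 (pd1 f) a b) (b + c * ev2 (pd2 f) a b) (c\<^sup>2 * grad_sq f a b) = 0 \<and>
    ev3 Q (a + c * ev2 (pd1 f) a b) (b + c * ev2 (pd2 f) a b) (c\<^sup>2 * grad_sq f a b) = 0"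
    if ab: "ev2 f a b = 0" "grad_sq f a b \<noteq> 0" for a b c
  proof -
    define x where "x = (\<lambda>c. a + c * ev2 (pd1 f) a b)"
    define y where "y = (\<lambda>c. b + c * ev2 (pd2 f) a b)"
    define h where "h = grad_sq f a b"
    define r where "r = csqrt h"
    have r: "r\<^sup>2 = h" "r \<noteq> 0" using ab(2) by (auto simp: r_def h_def)
    have even: "ev3 P (x c) (y c) (c\<^sup>2 * h) = 0 \<and> c * ev3 Q (x c) (y c) (c\<^sup>2 * h) = 0" for c
    proof -
      have sq: "(c * r)\<^sup>2 = c\<^sup>2 * h" "(- (c * r))\<^sup>2 = c\<^sup>2 * h" using r(1) by (simp_all add: power_mult_distrib)
      have "ev3 G (x c) (y c) (c * r) = 0" "ev3 G (x c) (y c) (- (c * r)) = 0"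
        using G offset_sysI[OF ab, of _ c] sq
        unfolding vanishes_on_offset_def x_def y_def h_def by blast+
      then have "ev3 P (x c) (y c) (c\<^sup>2 * h) + (c * r) * ev3 Q (x c) (y c) (c\<^sup>2 * h) = 0"
        "ev3 P (x c) (y c) (c\<^sup>2 * h) - (c * r) * ev3 Q (x c) (y c) (c\<^sup>2 * h) = 0"
        unfolding PQ sq by simp_all
      then have "2 * ev3 P (x c) (y c) (c\<^sup>2 * h) = 0"
        "2 * r * (c * ev3 Q (x c) (y c) (c\<^sup>2 * h)) = 0" by algebra+
      then show ?thesis using r(2) by simp
    qed
    obtain q where q: "\<And>c. poly q c = ev3 Q (x c) (y c) (c\<^sup>2 * h)"
      unfolding x_def y_def using ev3_along_normal_poly by blast
    \<comment> \<open>At \<open>c = 0\<close> the two signs coincide and give nothing about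
      \<open>Q\<close>; the factor \<open>c\<close> is therefore cancelled as a polynomial.\<close>
    have "poly ([:0, 1:] * q) c = 0" for c using even[of c] by (simp add: q)
    then have "[:0, 1:] * q = 0" using poly_all_0_iff_0 by blast
    then have "q = 0" by simp
    then show ?thesis using even[of c] q[of c] by (simp add: x_def y_def h_def)
  qed
  define f1 f2 where "f1 = ev2 (pd1 f) a b" and "f2 = ev2 (pd2 f) a b"
  have h0: "grad_sq f a b \<noteq> 0" using offset_sys_grad_sq[OF sys] by simp
  have fab: "ev2 f a b = 0" using sys by (simp add: offset_sys_def)
  obtain s where s: "s\<^sup>2 * grad_sq f a b = 1" "x1 = a + d * s * f1" "x2 = b + d * s * f2"
    unfolding f1_def f2_def using sys by (rule offset_sysE)
  \<comment> \<open>The squared family passes through the given point at parameter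
    \<open>c = d * s\<close>.\<close>
  have d2: "d\<^sup>2 = (d * s)\<^sup>2 * grad_sq f a b" using s(1) by (simp add: power_mult_distrib mult.assoc)
  have tang: "f1 * ev3 (map_poly pd2 P) x1 x2 (d\<^sup>2) = f2 * ev3 (pderiv P) x1 x2 (d\<^sup>2)"
    "f1 * ev3 (map_poly pd2 Q) x1 x2 (d\<^sup>2) = f2 * ev3 (pderiv Q) x1 x2 (d\<^sup>2)"
    unfolding s(2,3) f1_def f2_def d2
    by (rule squared_offset_gradient_normal[OF f _ fab h0]; use zero in blast)+
  have u: "((\<lambda>t. x1 - t * f2) has_field_derivative - f2) (at 0)"
    and v: "((\<lambda>t. x2 + t * f1) has_field_derivative f1) (at 0)"
    by (auto intro!: derivative_eq_intros)
  have "((\<lambda>t. ev3 P (x1 - t * f2) (x2 + t * f1) (d\<^sup>2) + d * ev3 Q (x1 - t * f2) (x2 + t * f1) (d\<^sup>2))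
    has_field_derivative
      (f1 * ev3 (map_poly pd2 P) x1 x2 (d\<^sup>2) - f2 * ev3 (pderiv P) x1 x2 (d\<^sup>2))
      + d * (f1 * ev3 (map_poly pd2 Q) x1 x2 (d\<^sup>2) - f2 * ev3 (pderiv Q) x1 x2 (d\<^sup>2))) (at 0)"
    using DERIV_add[OF has_field_derivative_ev3[OF u v DERIV_const, of P "d\<^sup>2"]
        DERIV_cmult[OF has_field_derivative_ev3[OF u v DERIV_const, of Q "d\<^sup>2"], of d]]
    by (simp add: algebra_simps)
  then have "((\<lambda>t. ev3 G (x1 - t * f2) (x2 + t * f1) d) has_field_derivative 0) (at 0)"
    unfolding tang PQ by simp
  moreover have "((\<lambda>t. ev3 G (x1 - t * f2) (x2 + t * f1) d) has_field_derivative
      f1 * ev3 (map_poly pd2 G) x1 x2 d - f2 * ev3 (pderiv G) x1 x2 d) (at 0)"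
    using has_field_derivative_ev3[OF u v DERIV_const, of G d] by (simp add: algebra_simps)
  ultimately have "f1 * ev3 (map_poly pd2 G) x1 x2 d - f2 * ev3 (pderiv G) x1 x2 d = 0"
    using DERIV_unique by fastforce
  then show ?thesis by (simp add: f1_def f2_def)
qed

text \<open>With N the unit normal \<open>s\<close> times the gradient of \<open>f\<close>, the line
  (y + t N, t) stays on the offset; differentiating at \<open>t = d\<close> gives the normal
  component of the x-gradient of \<open>G\<close>. The tangential component vanishes by
  \<open>offset_gradient_normal\<close>.\<close>

lemma offset_gradient:
  assumes f: "prime_elem f" "degree f > 0" "\<not> f dvd pd1 f ^ 2 + pd2 f ^ 2"
    and G: "vanishes_on_offset f G"
    and sys: "offset_sys f (a, b) (x1, x2) u d"
  obtains s where "x1 = a + d * s * ev2 (pd1 f) a b" "x2 = b + d * s * ev2 (pd2 f) a b"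
    "ev3 (pderiv G) x1 x2 d = - s * ev2 (pd1 f) a b * ev3 (map_poly pd1 G) x1 x2 d"
    "ev3 (map_poly pd2 G) x1 x2 d = - s * ev2 (pd2 f) a b * ev3 (map_poly pd1 G) x1 x2 d"
proof -
  define f1 f2 h where "f1 = ev2 (pd1 f) a b" and "f2 = ev2 (pd2 f) a b" and "h = grad_sq f a b"
  have h: "h = f1 * f1 + f2 * f2" unfolding h_def f1_def f2_def grad_sq_def
    by (simp add: power2_eq_square)
  obtain s where s: "s\<^sup>2 * h = 1" "x1 = a + d * s * f1" "x2 = b + d * s * f2"
    unfolding f1_def f2_def h_def using sys by (rule offset_sysE)
  define G1 G2 G3 where "G1 = ev3 (pderiv G) x1 x2 d" and "G2 = ev3 (map_poly pd2 G) x1 x2 d"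
    and "G3 = ev3 (map_poly pd1 G) x1 x2 d"
  have T: "f1 * G2 = f2 * G1"
    using offset_gradient_normal[OF f G sys] by (simp add: f1_def f2_def G1_def G2_def)
  have "ev3 G (a + t * s * f1) (b + t * s * f2) t = 0" for t
  proof -
    have "t\<^sup>2 = (t * s)\<^sup>2 * grad_sq f a b"
      using s(1) by (simp add: h_def power_mult_distrib mult.assoc)
    moreover have "ev2 f a b = 0" using sys by (simp add: offset_sys_def)
    ultimately show ?thesis
      using G offset_sysI[of f a b t "t * s"] offset_sys_grad_sq(1)[OF sys]
      unfolding vanishes_on_offset_def f1_def f2_def by blast
  qed
  moreover have u: "((\<lambda>t. a + t * s * f1) has_field_derivative s * f1) (at d)"
    and v: "((\<lambda>t. b + t * s * f2) has_field_derivative s * f2) (at d)"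
    by (auto intro!: derivative_eq_intros)
  ultimately have "((\<lambda>t. 0) has_field_derivative G1 * (s * f1) + G2 * (s * f2) + G3) (at d)"
    using has_field_derivative_ev3[OF u v DERIV_ident, of G] s(2,3)
    by (simp add: G1_def G2_def G3_def)
  then have N: "G1 * (s * f1) + G2 * (s * f2) + G3 = 0"
    using DERIV_unique[OF _ DERIV_const] by blast
  \<comment> \<open>Inserting \<open>s^2 * h = 1\<close> projects the gradient onto the unit normal;
    the relation \<open>T\<close> supplies the missing cross term.\<close>
  have "G1 = s\<^sup>2 * h * G1" using s(1) by simp
  also have "\<dots> = s * f1 * (G1 * (s * f1)) + s * s * f2 * (f2 * G1)"
    unfolding h by (simp add: algebra_simps power2_eq_square)
  also have "\<dots> = s * f1 * (G1 * (s * f1) + G2 * (s * f2))"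
    unfolding T[symmetric] by (simp add: algebra_simps)
  also have "\<dots> = - s * f1 * G3" using N by (simp add: add_eq_0_iff2)
  finally have 1: "G1 = - s * f1 * G3" .
  have "G2 = s\<^sup>2 * h * G2" using s(1) by simp
  also have "\<dots> = s * f2 * (G2 * (s * f2)) + s * s * f1 * (f1 * G2)"
    unfolding h by (simp add: algebra_simps power2_eq_square)
  also have "\<dots> = s * f2 * (G1 * (s * f1) + G2 * (s * f2))"
    unfolding T by (simp add: algebra_simps)
  also have "\<dots> = - s * f2 * G3" using N by (simp add: add_eq_0_iff2)
  finally have 2: "G2 = - s * f2 * G3" .
  show thesis
    using that[of s] s(2,3) 1 2 unfolding f1_def f2_def G1_def G2_def G3_def by blast
qed

subsection \<open>The foot point as a rational function on the generic offset\<close>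

lemma offset_eq_vanishes:
  assumes "is_generic_offset_eq f g"
  shows "vanishes_on_offset f g"
proof -
  have "{(x1, x2, d). \<exists>y u. offset_sys f y (x1, x2) u d} \<subseteq> {(x1, x2, d). ev3 g x1 x2 d = 0}"
    using assms unfolding is_generic_offset_eq_def generic_offset_def zclosure3_def by blast
  then show ?thesis unfolding vanishes_on_offset_def by blast
qed

text \<open>Zeros of \<open>g\<close> need not lift to the system, since a closure is taken. This
  lets a polynomial identity checked at liftable points pass to all zeros of
  \<open>g\<close>.\<close>

lemma vanishes_on_offset_eq:
  assumes "is_generic_offset_eq f g" "vanishes_on_offset f G" "ev3 g x1 x2 d = 0"
  shows "ev3 G x1 x2 d = 0"
proof -
  let ?Z = "{(x1, x2, d). ev3 G x1 x2 d = 0}"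
  have "zariski_closed3 ?Z" unfolding zariski_closed3_def by (rule exI[of _ "{G}"]) simp
  moreover have "{(x1, x2, d). \<exists>y u. offset_sys f y (x1, x2) u d} \<subseteq> ?Z"
    using assms(2) unfolding vanishes_on_offset_def by auto
  ultimately have "generic_offset f \<subseteq> ?Z" unfolding generic_offset_def zclosure3_def by blast
  moreover have "(x1, x2, d) \<in> generic_offset f"
    using assms(1,3) unfolding is_generic_offset_eq_def by auto
  ultimately show ?thesis by blast
qed

lemma squarefree_cofactor:
  assumes "squarefree (p * r)" "prime_elem p"
  shows "\<not> p dvd r"
proof
  assume "p dvd r"
  then have "p ^ 2 dvd p * r" by (simp add: power2_eq_square mult_dvd_mono)
  then show False using assms unfolding squarefree_def by (auto simp: prime_elem_not_unit)
qed

text \<open>By the product rule \<open>p\<close> would divide its own derivative, which in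
  characteristic 0 is nonzero and of smaller degree.\<close>

lemma squarefree_pderiv:
  fixes p g :: "complex poly poly poly"
  assumes "squarefree g" "prime_elem p" "degree p > 0" "p dvd g"
  shows "\<not> p dvd pderiv g"
proof
  assume *: "p dvd pderiv g"
  obtain r where r: "g = p * r" using assms(4) by blast
  have "p dvd r * pderiv p" using * unfolding r pderiv_mult by (simp add: dvd_add_right_iff)
  moreover have "\<not> p dvd r" using squarefree_cofactor assms(1,2) r by blast
  ultimately have "p dvd pderiv p" using assms(2) prime_elem_dvd_mult_iff by blast
  moreover have "pderiv p \<noteq> 0" using assms(3) by (simp add: pderiv_eq_0_iff)
  ultimately have "degree p \<le> degree (pderiv p)" by (rule dvd_imp_degree_le)
  then show False using assms(3) by (simp add: degree_pderiv)
qed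

text \<open>If the d-derivative of \<open>g\<close> vanished on the component \<open>p\<close>, then
  by \<open>offset_gradient\<close> so would the x1-derivative at the liftable points of
  \<open>p\<close>. Multiplying by the cofactor \<open>r\<close> takes care of the other components,
  and closure yields that \<open>p\<close> divides \<open>r * pderiv g\<close>, against
  square-freeness.\<close>

lemma offset_eq_no_critical_component:
  assumes f: "prime_elem f" "degree f > 0" "\<not> f dvd pd1 f ^ 2 + pd2 f ^ 2"
    and g: "is_generic_offset_eq f g"
    and p: "prime_elem p" "degree p > 0" "p dvd g"
  shows "\<not> p dvd map_poly pd1 g"
proof
  assume *: "p dvd map_poly pd1 g"
  obtain r where r: "g = p * r" using p(3) by blast
  have sf: "squarefree g" using g by (simp add: is_generic_offset_eq_def)
  have "vanishes_on_offset f (r * pderiv g)"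
    unfolding vanishes_on_offset_def
  proof (intro allI impI)
    fix a b x1 x2 u d assume sys: "offset_sys f (a, b) (x1, x2) u d"
    have "ev3 g x1 x2 d = 0"
      using offset_eq_vanishes[OF g] sys unfolding vanishes_on_offset_def by blast
    then consider "ev3 r x1 x2 d = 0" | "ev3 p x1 x2 d = 0" unfolding r by auto
    then show "ev3 (r * pderiv g) x1 x2 d = 0"
    proof cases
      case 2
      then have "ev3 (map_poly pd1 g) x1 x2 d = 0" using * by (auto elim!: dvdE)
      then have "ev3 (pderiv g) x1 x2 d = 0"
        using offset_gradient[OF f offset_eq_vanishes[OF g] sys] by (metis mult_zero_right)
      then show ?thesis by simp
    qed simp
  qed
  from vanishes_on_offset_eq[OF g this] have "p dvd r * pderiv g"
    by (intro ev3_prime_elem_dvd[OF p(1,2)]) (simp add: r)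
  then show False
    using squarefree_pderiv[OF sf p] squarefree_cofactor[of p r] sf r p(1)
    by (auto simp: prime_elem_dvd_mult_iff)
qed

text \<open>The coordinates of x - d N, read off from the gradient of \<open>g\<close>. Where the
  d-derivative vanishes, division by zero makes the value just that of x.\<close>

definition foot1 :: "complex poly poly poly \<Rightarrow> complex \<times> complex \<times> complex \<Rightarrow> complex" where
  "foot1 g = (\<lambda>(x1, x2, d). x1 + d * (ev3 (pderiv g) x1 x2 d / ev3 (map_poly pd1 g) x1 x2 d))"

definition foot2 :: "complex poly poly poly \<Rightarrow> complex \<times> complex \<times> complex \<Rightarrow> complex" where
  "foot2 g = (\<lambda>(x1, x2, d). x2 + d * (ev3 (map_poly pd2 g) x1 x2 d / ev3 (map_poly pd1 g) x1 x2 d))"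

lemma foot_unique:
  assumes f: "prime_elem f" "degree f > 0" "\<not> f dvd pd1 f ^ 2 + pd2 f ^ 2"
    and g: "is_generic_offset_eq f g"
    and sys: "offset_sys f (a, b) (x1, x2) u d"
    and "ev3 (map_poly pd1 g) x1 x2 d \<noteq> 0"
  shows "a = foot1 g (x1, x2, d)" "b = foot2 g (x1, x2, d)"
proof -
  obtain s where "x1 = a + d * s * ev2 (pd1 f) a b" "x2 = b + d * s * ev2 (pd2 f) a b"
    "ev3 (pderiv g) x1 x2 d = - s * ev2 (pd1 f) a b * ev3 (map_poly pd1 g) x1 x2 d"
    "ev3 (map_poly pd2 g) x1 x2 d = - s * ev2 (pd2 f) a b * ev3 (map_poly pd1 g) x1 x2 d"
    by (rule offset_gradient[OF f offset_eq_vanishes[OF g] sys])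
  then show "a = foot1 g (x1, x2, d)" "b = foot2 g (x1, x2, d)"
    using assms(6) by (simp_all add: foot1_def foot2_def)
qed

lemma foot_in_funs3_loc:
  "foot1 g \<in> funs3_loc (map_poly pd1 g)" "foot2 g \<in> funs3_loc (map_poly pd1 g)"
proof -
  note A = fun_algebra_funs3_loc[of "map_poly pd1 g"]
  show "foot1 g \<in> funs3_loc (map_poly pd1 g)"
    using fun_algebra_add[OF A coordinates_in_funs3_loc(1)
        fun_algebra_mult[OF A coordinates_in_funs3_loc(3) quotient_in_funs3_loc[of "pderiv g"]]]
    by (simp add: foot1_def case_prod_unfold)
  show "foot2 g \<in> funs3_loc (map_poly pd1 g)"
    using fun_algebra_add[OF A coordinates_in_funs3_loc(2)
        fun_algebra_mult[OF A coordinates_in_funs3_loc(3) quotient_in_funs3_loc[of "map_poly pd2 g"]]]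
    by (simp add: foot2_def case_prod_unfold)
qed

text \<open>After clearing denominators, one more factor \<open>w\<close> makes the polynomial
  vanish also at the liftable points with \<open>w = 0\<close>, about which \<open>zero\<close> says
  nothing.\<close>

lemma funs3_loc_zero_on_offset_eq:
  assumes g: "is_generic_offset_eq f g"
    and F: "F \<in> funs3_loc w"
    and zero: "\<And>a b x1 x2 u d. offset_sys f (a, b) (x1, x2) u d \<Longrightarrow> ev3 w x1 x2 d \<noteq> 0 \<Longrightarrow>
      F (x1, x2, d) = 0"
    and x: "ev3 g x1 x2 d = 0" "ev3 w x1 x2 d \<noteq> 0"
  shows "F (x1, x2, d) = 0"
proof -
  obtain n G where G: "\<And>x1 x2 d. ev3 w x1 x2 d \<noteq> 0 \<Longrightarrow>
      ev3 w x1 x2 d ^ n * F (x1, x2, d) = ev3 G x1 x2 d"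
    using F unfolding funs3_loc_def by blast
  have "vanishes_on_offset f (w * G)"
    unfolding vanishes_on_offset_def
  proof (intro allI impI)
    fix a b x1 x2 u d assume "offset_sys f (a, b) (x1, x2) u d"
    then show "ev3 (w * G) x1 x2 d = 0"
      using zero[of a b x1 x2 u d] G[of x1 x2 d] by (cases "ev3 w x1 x2 d = 0") auto
  qed
  from vanishes_on_offset_eq[OF g this x(1)] show ?thesis using G[OF x(2)] x(2) by auto
qed

text \<open>At a liftable point the rational foot point is the actual generator, so the three
  equations hold there; as identities of rational functions they extend to the zeros of
  \<open>g\<close>. The remaining equation w is an inequation in disguise and is left to
  \<open>generic_foot\<close>.\<close>

lemma foot_satisfies_system:
  assumes f: "prime_elem f" "degree f > 0" "\<not> f dvd pd1 f ^ 2 + pd2 f ^ 2"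
    and g: "is_generic_offset_eq f g"
    and x: "ev3 g x1 x2 d = 0" "ev3 (map_poly pd1 g) x1 x2 d \<noteq> 0"
  defines "y \<equiv> (foot1 g (x1, x2, d), foot2 g (x1, x2, d))"
  shows "ev2 f (fst y) (snd y) = 0" "bpol y (x1, x2) d = 0" "npol f y (x1, x2) = 0"
proof -
  let ?w = "map_poly pd1 g"
  note A = fun_algebra_funs3_loc[of ?w]
  note closure = fun_algebra_ev2[OF A] fun_algebra_diff[OF A] fun_algebra_add[OF A]
    fun_algebra_mult[OF A] foot_in_funs3_loc coordinates_in_funs3_loc
  let ?x1 = "\<lambda>(x1, x2, d). x1" and ?x2 = "\<lambda>(x1, x2, d). x2" and ?d = "\<lambda>(x1, x2, d). d"
  let ?y1 = "\<lambda>z. foot1 g z" and ?y2 = "\<lambda>z. foot2 g z"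
  let ?F = "\<lambda>z. ev2 f (?y1 z) (?y2 z)"
  let ?B = "\<lambda>z. (?x1 z - ?y1 z) * (?x1 z - ?y1 z) + (?x2 z - ?y2 z) * (?x2 z - ?y2 z) - ?d z * ?d z"
  let ?N = "\<lambda>z. ev2 (pd1 f) (?y1 z) (?y2 z) * (?x2 z - ?y2 z)
    - ev2 (pd2 f) (?y1 z) (?y2 z) * (?x1 z - ?y1 z)"
  have sys: "?F (x1, x2, d) = 0 \<and> ?B (x1, x2, d) = 0 \<and> ?N (x1, x2, d) = 0"
    if "offset_sys f (a, b) (x1, x2) u d" "ev3 ?w x1 x2 d \<noteq> 0" for a b x1 x2 u d
    using that(1) foot_unique[OF f g that]
    by (simp add: offset_sys_def bpol_def npol_def power2_eq_square)
  have "?F \<in> funs3_loc ?w" "?B \<in> funs3_loc ?w" "?N \<in> funs3_loc ?w"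
    by (intro closure)+
  from this[THEN funs3_loc_zero_on_offset_eq[OF g _ _ x]] sys
  have "?F (x1, x2, d) = 0" "?B (x1, x2, d) = 0" "?N (x1, x2, d) = 0" by blast+
  then show "ev2 f (fst y) (snd y) = 0" "bpol y (x1, x2) d = 0" "npol f y (x1, x2) = 0"
    by (simp_all add: y_def bpol_def npol_def power2_eq_square)
qed

text \<open>\<open>H\<close> is the squared gradient at the foot point with denominators cleared. At
  a liftable point that squared gradient is nonzero, so a component \<open>p\<close> dividing
  \<open>H\<close> would force the d-derivative of \<open>g\<close> to vanish at the liftable points
  of \<open>p\<close>, which \<open>offset_eq_no_critical_component\<close> excludes after
  closure.\<close>

lemma generic_foot:
  assumes f: "prime_elem f" "degree f > 0" "\<not> f dvd pd1 f ^ 2 + pd2 f ^ 2"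
    and g: "is_generic_offset_eq f g"
  obtains R where "R \<noteq> 0"
    "\<And>x1 x2 d. ev2 R d x2 \<noteq> 0 \<Longrightarrow> ev3 g x1 x2 d = 0 \<Longrightarrow>
      ev3 (map_poly pd1 g) x1 x2 d \<noteq> 0 \<and>
      grad_sq f (foot1 g (x1, x2, d)) (foot2 g (x1, x2, d)) \<noteq> 0"
proof -
  let ?w = "map_poly pd1 g"
  note A = fun_algebra_funs3_loc[of ?w]
  have sf: "squarefree g" using g by (simp add: is_generic_offset_eq_def)
  then have g0: "g \<noteq> 0" by auto
  have "(\<lambda>z. ev2 (pd1 f) (foot1 g z) (foot2 g z) * ev2 (pd1 f) (foot1 g z) (foot2 g z)
      + ev2 (pd2 f) (foot1 g z) (foot2 g z) * ev2 (pd2 f) (foot1 g z) (foot2 g z)) \<in> funs3_loc ?w"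
    by (intro fun_algebra_ev2[OF A] fun_algebra_add[OF A] fun_algebra_mult[OF A] foot_in_funs3_loc)
  then obtain n H where H: "\<And>x1 x2 d. ev3 ?w x1 x2 d \<noteq> 0 \<Longrightarrow>
      ev3 ?w x1 x2 d ^ n * grad_sq f (foot1 g (x1, x2, d)) (foot2 g (x1, x2, d)) = ev3 H x1 x2 d"
    unfolding funs3_loc_def grad_sq_def power2_eq_square by blast
  have coprime: "\<not> p dvd ?w * H" if p: "prime_elem p" "degree p > 0" "p dvd g" for p
  proof
    assume "p dvd ?w * H"
    moreover have w: "\<not> p dvd ?w" by (rule offset_eq_no_critical_component[OF f g p])
    ultimately have pH: "p dvd H" using p(1) by (simp add: prime_elem_dvd_mult_iff)
    obtain r where r: "g = p * r" using p(3) by blast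
    have "vanishes_on_offset f (r * ?w)"
      unfolding vanishes_on_offset_def
    proof (intro allI impI)
      fix a b x1 x2 u d assume sys: "offset_sys f (a, b) (x1, x2) u d"
      have "ev3 g x1 x2 d = 0"
        using offset_eq_vanishes[OF g] sys unfolding vanishes_on_offset_def by blast
      then consider "ev3 r x1 x2 d = 0" | "ev3 p x1 x2 d = 0" unfolding r by auto
      then show "ev3 (r * ?w) x1 x2 d = 0"
      proof cases
        case 2
        then have "ev3 H x1 x2 d = 0" using pH by (auto elim!: dvdE)
        then have "ev3 ?w x1 x2 d = 0"
          using H[of x1 x2 d] foot_unique[OF f g sys] offset_sys_grad_sq(1)[OF sys] by force
        then show ?thesis by simp
      qed simp
    qed
    from vanishes_on_offset_eq[OF g this] have "p dvd r * ?w"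
      by (intro ev3_prime_elem_dvd[OF p(1,2)]) (simp add: r)
    then show False
      using w squarefree_cofactor[of p r] sf r p(1) by (auto simp: prime_elem_dvd_mult_iff)
  qed
  obtain R where R: "R \<noteq> 0" "\<And>x1 x2 d. ev2 R d x2 \<noteq> 0 \<Longrightarrow> ev3 g x1 x2 d = 0 \<Longrightarrow>
      ev3 (?w * H) x1 x2 d \<noteq> 0"
    using ev3_no_common_root[OF g0 coprime] by blast
  have "ev3 ?w x1 x2 d \<noteq> 0 \<and> grad_sq f (foot1 g (x1, x2, d)) (foot2 g (x1, x2, d)) \<noteq> 0"
    if "ev2 R d x2 \<noteq> 0" "ev3 g x1 x2 d = 0" for x1 x2 d
    using R(2)[OF that] H[of x1 x2 d] by auto
  with R(1) show thesis by (rule that)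
qed

subsection \<open>Ramification points\<close>

text \<open>Otherwise \<open>f\<close> involves only the first coordinate; over the complex numbers
  an irreducible such polynomial is linear and defines a vertical line.\<close>

lemma irreducible_not_line_degree_pos:
  assumes irr: "irreducible f" and not_line: "\<not> is_line (curve f)"
  shows "degree f > 0"
proof (rule ccontr)
  assume "\<not> degree f > 0"
  then obtain q where q: "f = [:q:]" using degree_eq_zeroE by blast
  have "degree q > 0"
    using irr unfolding q by (auto simp: irreducible_def is_unit_const_poly_iff is_unit_iff_degree)
  then have "\<not> constant (poly q)" by (simp add: constant_degree)
  then obtain a where a: "poly q a = 0" using fundamental_theorem_of_algebra by blast
  then have "[:[:-a, 1:]:] dvd f" unfolding q by (simp add: poly_eq_0_iff_dvd)
  moreover have "\<not> is_unit [:[:-a, 1:]:]" by (simp add: is_unit_const_poly_iff is_unit_pCons_iff)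
  ultimately have "f dvd [:[:-a, 1:]:]" using irr irreducibleD' by blast
  then have "q dvd [:-a, 1:]" unfolding q by simp
  then obtain k where k: "[:-a, 1:] = q * k" by (rule dvdE)
  have "x = a" if "poly q x = 0" for x
    using arg_cong[OF k, of "\<lambda>p. poly p x"] that by simp
  then have "poly q x = 0 \<longleftrightarrow> x = a" for x using a by blast
  then have "curve f = {(y1, y2). 1 * y1 + 0 * y2 + (- a) = 0}"
    unfolding curve_def q by auto
  then have "is_line (curve f)" unfolding is_line_def by (metis prod.inject zero_neq_one)
  with not_line show False by simp
qed

text \<open>Ramification points are finite in number. Elimination bounds their first coordinates,
  not their heights \<open>k\<close>; an irreducible \<open>f\<close> of positive degree contains no
  vertical line, so only finitely many heights lie over each root of \<open>R\<close>.
  \<open>W\<close> is the product of \<open>k - v\<close> over these heights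
  \<open>v\<close>.\<close>

lemma generic_not_ramification:
  assumes irr: "irreducible f" and deg: "degree f > 0"
  obtains W where "W \<noteq> 0" "\<And>a k d. ramification_pt f (a, k) \<Longrightarrow> ev2 W d k = 0"
proof -
  have prime: "prime_elem f" using irr by (rule irreducible_imp_prime_elem_gcd)
  have "pd2 f \<noteq> 0" using deg by (simp add: pd2_def pderiv_eq_0_iff)
  then have "\<not> f dvd pd2 f"
    using dvd_imp_degree_le[of f "pd2 f"] deg by (auto simp: pd2_def degree_pderiv)
  then obtain A B R where R: "R \<noteq> 0" and eq: "A * f + B * pd2 f = [:R:]"
    by (rule prime_elem_bezout[OF prime])
  define V where "V = (\<Union>a\<in>{a. poly R a = 0}. {b. ev2 f a b = 0})"
  have "finite {b. ev2 f a b = 0}" for a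
  proof -
    have "map_poly (\<lambda>c. poly c a) f \<noteq> 0"
    proof
      assume "map_poly (\<lambda>c. poly c a) f = 0"
      then have "coeff (map_poly (\<lambda>c. poly c a) f) n = 0" for n by simp
      then have "[:-a, 1:] dvd coeff f n" for n by (simp add: coeff_map_poly poly_eq_0_iff_dvd)
      then have "[:[:-a, 1:]:] dvd f" by (simp add: const_poly_dvd_iff)
      moreover have "\<not> is_unit [:[:-a, 1:]:]" by (simp add: is_unit_const_poly_iff is_unit_pCons_iff)
      ultimately have "f dvd [:[:-a, 1:]:]" using irr irreducibleD' by blast
      then show False using deg dvd_imp_degree_le[of f "[:[:-a, 1:]:]"] by simp
    qed
    then show ?thesis unfolding ev2_def by (rule poly_roots_finite)
  qed
  then have fin: "finite V" unfolding V_def using R by (intro finite_UN_I poly_roots_finite) auto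
  define S where "S = (\<Prod>v\<in>V. [:- v, 1:])"
  have S0: "S \<noteq> 0" unfolding S_def using fin by simp
  have A: "(\<lambda>z. poly S (snd z)) \<in> funs2"
    by (rule fun_algebra_poly[OF fun_algebra_funs2 snd_in_funs2])
  obtain W where W: "\<And>d k. ev2 W d k = poly S k" using in_funs2E[OF A] by auto
  have "W \<noteq> 0"
  proof
    assume "W = 0"
    then have "poly S k = 0" for k using W[of 0 k] by simp
    then show False using S0 poly_all_0_iff_0 by blast
  qed
  moreover have "ev2 W d k = 0" if "ramification_pt f (a, k)" for a k d
  proof -
    have "ev2 f a k = 0" "ev2 (pd2 f) a k = 0"
      using that by (auto simp: ramification_pt_def curve_def)
    then have "k \<in> V" using arg_cong[OF eq, of "\<lambda>F. ev2 F a k"] unfolding V_def by auto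
    then show ?thesis using fin by (auto simp: W S_def poly_prod)
  qed
  ultimately show thesis by (rule that)
qed

section \<open>Horizontal slices and assembly of the theorem\<close>

lemma card_roots_slice3:
  assumes "ev2 (lead_coeff g) d x2 \<noteq> 0"
    and "\<And>x1. ev3 g x1 x2 d = 0 \<Longrightarrow> ev3 (pderiv g) x1 x2 d \<noteq> 0"
  shows "finite {x1. ev3 g x1 x2 d = 0}" "card {x1. ev3 g x1 x2 d = 0} = degree g"
proof -
  define q where "q = map_poly (\<lambda>c. ev2 c d x2) g"
  have q: "poly q x1 = ev3 g x1 x2 d" for x1 by (simp add: q_def ev3_def)
  have q': "poly (pderiv q) x1 = ev3 (pderiv g) x1 x2 d" for x1
  proof -
    have "((\<lambda>x1. ev3 g x1 x2 d) has_field_derivative ev3 (pderiv g) x1 x2 d) (at x1)"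
      using has_field_derivative_ev3[OF DERIV_ident DERIV_const DERIV_const, of g x2 d x1] by simp
    then show ?thesis using poly_DERIV[of q x1] DERIV_unique unfolding q by blast
  qed
  have "degree q = degree g" unfolding q_def by (rule degree_slice3[OF assms(1)])
  have q0: "q \<noteq> 0"
  proof
    assume "q = 0"
    then have "coeff q (degree g) = 0" by simp
    then show False using assms(1) by (simp add: q_def coeff_map_poly)
  qed
  have "rsquarefree q" unfolding rsquarefree_roots q q' using assms(2) by blast
  then have "q = smult (lead_coeff q) (\<Prod>z|poly q z = 0. [:-z, 1:])"
    by (rule complex_poly_decompose_rsquarefree[symmetric])
  then have "degree q = degree (\<Prod>z|poly q z = 0. [:-z, 1:])"
    using q0 by (metis degree_smult_eq leading_coeff_0_iff)
  also have "\<dots> = (\<Sum>z|poly q z = 0. degree [:-z, 1:])" by (rule degree_prod_eq_sum_degree) simp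
  finally have "degree q = card {z. poly q z = 0}" by simp
  with \<open>degree q = degree g\<close> show "card {x1. ev3 g x1 x2 d = 0} = degree g" by (simp add: q)
  show "finite {x1. ev3 g x1 x2 d = 0}" using poly_roots_finite[OF q0] by (simp add: q)
qed

lemma offset_subset_slice:
  assumes "is_generic_offset_eq f g" "(x1, x2) \<in> offset f d"
  shows "ev3 g x1 x2 d = 0"
proof -
  obtain P where P: "\<And>x1 x2. ev2 P x1 x2 = ev3 g x1 x2 d" using ev3_slice by blast
  let ?Z = "{(x1, x2). ev2 P x1 x2 = 0}"
  have "zariski_closed2 ?Z" unfolding zariski_closed2_def by (rule exI[of _ "{P}"]) simp
  moreover have "{x. \<exists>y u. offset_sys f y x u d} \<subseteq> ?Z"
    using offset_eq_vanishes[OF assms(1)] unfolding vanishes_on_offset_def P by auto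
  ultimately have "offset f d \<subseteq> ?Z" unfolding offset_def zclosure2_def by blast
  then show ?thesis using assms(2) by (auto simp: P)
qed

theorem mainTheorem3:
  fixes f :: "complex poly poly" and g :: "complex poly poly poly"
  assumes irr: "irreducible f"
    and not_line: "\<not> is_line (curve f)"
    and not_dvd: "\<not> f dvd (pd1 f ^ 2 + pd2 f ^ 2)"
    and g: "is_generic_offset_eq f g"
  shows "\<exists>\<Delta> :: (complex \<times> complex) set. zariski_open2 \<Delta> \<and> \<Delta> \<noteq> {} \<and>
    (\<forall>(d0, k0) \<in> \<Delta>. d0 \<noteq> 0 \<and>
      (\<exists>p q :: nat \<Rightarrow> complex \<times> complex. \<exists>u :: nat \<Rightarrow> complex.
          {(y, x, v). sys2 f d0 k0 y x v} = (\<lambda>i. (p i, q i, u i)) ` {..<deg_x1 g}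
        \<and> inj_on q {..<deg_x1 g}
        \<and> line2 k0 \<inter> offset f d0 = q ` {..<deg_x1 g}
        \<and> inj_on p {..<deg_x1 g}
        \<and> (\<forall>i < deg_x1 g. regular_pt f (p i) \<and> \<not> ramification_pt f (p i)))
      \<and> (\<forall>p \<in> curve f. snd p = k0 \<longrightarrow> \<not> ramification_pt f p))"
proof -
  have deg: "degree f > 0" using irr not_line by (rule irreducible_not_line_degree_pos)
  have prime: "prime_elem f" using irr by (rule irreducible_imp_prime_elem_gcd)
  note f = prime deg not_dvd
  have sf: "squarefree g" using g by (simp add: is_generic_offset_eq_def)
  then have g0: "g \<noteq> 0" by auto
  obtain R where R: "R \<noteq> 0" "\<And>x1 x2 d. ev2 R d x2 \<noteq> 0 \<Longrightarrow> ev3 g x1 x2 d = 0 \<Longrightarrow>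
      ev3 (map_poly pd1 g) x1 x2 d \<noteq> 0 \<and>
      grad_sq f (foot1 g (x1, x2, d)) (foot2 g (x1, x2, d)) \<noteq> 0"
    using generic_foot[OF f g] by blast
  obtain D where D: "D \<noteq> 0" "\<And>x1 x2 d. ev2 D d x2 \<noteq> 0 \<Longrightarrow> ev3 g x1 x2 d = 0 \<Longrightarrow>
      ev3 (pderiv g) x1 x2 d \<noteq> 0"
    using ev3_no_common_root[OF g0 squarefree_pderiv[OF sf]] by blast
  obtain W where W: "W \<noteq> 0" "\<And>a k d. ramification_pt f (a, k) \<Longrightarrow> ev2 W d k = 0"
    using generic_not_ramification[OF irr deg] by blast
  \<comment> \<open>The factors exclude, in order: distance 0; a foot point that is undefined or has
    zero squared gradient; multiple roots in x1; lines through ramification points; and a drop of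
    the degree in x1.\<close>
  define U where "U = [:[:0, 1:]:] * R * D * W * lead_coeff g"
  have "U \<noteq> 0" unfolding U_def using R(1) D(1) W(1) g0 by auto
  define \<Delta> where "\<Delta> = {(d, k). ev2 U d k \<noteq> 0}"
  have "- \<Delta> = {(d, k). \<forall>p\<in>{U}. ev2 p d k = 0}" unfolding \<Delta>_def by auto
  then have "zariski_open2 \<Delta>" unfolding zariski_open2_def zariski_closed2_def by blast
  moreover have "\<Delta> \<noteq> {}"
    by (rule ev2_neq_0[OF \<open>U \<noteq> 0\<close>]) (auto simp: \<Delta>_def)
  moreover have "d0 \<noteq> 0 \<and>
      (\<exists>p q :: nat \<Rightarrow> complex \<times> complex. \<exists>u :: nat \<Rightarrow> complex.
          {(y, x, v). sys2 f d0 k0 y x v} = (\<lambda>i. (p i, q i, u i)) ` {..<deg_x1 g}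
        \<and> inj_on q {..<deg_x1 g}
        \<and> line2 k0 \<inter> offset f d0 = q ` {..<deg_x1 g}
        \<and> inj_on p {..<deg_x1 g}
        \<and> (\<forall>i < deg_x1 g. regular_pt f (p i) \<and> \<not> ramification_pt f (p i)))
      \<and> (\<forall>p \<in> curve f. snd p = k0 \<longrightarrow> \<not> ramification_pt f p)"
    if "(d0, k0) \<in> \<Delta>" for d0 k0
  proof (intro conjI)
    have nz: "d0 \<noteq> 0" "ev2 R d0 k0 \<noteq> 0" "ev2 D d0 k0 \<noteq> 0" "ev2 W d0 k0 \<noteq> 0"
      "ev2 (lead_coeff g) d0 k0 \<noteq> 0"
      using that by (auto simp: \<Delta>_def U_def)
    show "d0 \<noteq> 0" by (rule nz)
    have no_ram: "\<not> ramification_pt f p" if "snd p = k0" for p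
      using W(2)[of "fst p" k0 d0] nz(4) that by (cases p) auto
    then show "\<forall>p \<in> curve f. snd p = k0 \<longrightarrow> \<not> ramification_pt f p" by blast
    define X where "X = {x1. ev3 g x1 k0 d0 = 0}"
    have X: "finite X" "card X = deg_x1 g"
      unfolding X_def deg_x1_def
      using card_roots_slice3[OF nz(5)] D(2)[OF nz(3)] by blast+
    from ex_bij_betw_nat_finite[OF X(1)]
    obtain e where e: "bij_betw e {..<deg_x1 g} X" by (auto simp: X(2) atLeast0LessThan)
    define y where "y = (\<lambda>x1. (foot1 g (x1, k0, d0), foot2 g (x1, k0, d0)))"
    define v where "v = (\<lambda>x1. 1 / grad_sq f (fst (y x1)) (snd (y x1)))"
    have lift: "offset_sys f (y x1) (x1, k0) (v x1) d0" if "x1 \<in> X" for x1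
    proof -
      have x1: "ev3 g x1 k0 d0 = 0" using that by (simp add: X_def)
      have w: "ev3 (map_poly pd1 g) x1 k0 d0 \<noteq> 0" and h: "grad_sq f (fst (y x1)) (snd (y x1)) \<noteq> 0"
        using R(2)[OF nz(2) x1] by (simp_all add: y_def)
      have "wpol f (y x1) (v x1) = 0"
        using h by (simp add: wpol_def v_def grad_sq_def)
      then show ?thesis
        using foot_satisfies_system[OF f g x1 w] unfolding offset_sys_def y_def by blast
    qed
    have unique: "x1 \<in> X \<and> z = y x1 \<and> u = v x1" if "offset_sys f z (x1, k0) u d0" for z x1 u
    proof -
      obtain a b where z: "z = (a, b)" by (cases z)
      have x1: "ev3 g x1 k0 d0 = 0"
        using offset_eq_vanishes[OF g] that unfolding vanishes_on_offset_def z by blast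
      have "z = y x1"
        using foot_unique[OF f g that[unfolded z]] R(2)[OF nz(2) x1] by (simp add: z y_def)
      moreover have "u = 1 / grad_sq f (fst z) (snd z)"
        using offset_sys_grad_sq(2)[OF that[unfolded z]] by (simp add: z)
      ultimately show ?thesis using x1 by (simp add: X_def v_def)
    qed
    \<comment> \<open>If f2 vanished at the foot point, the normal there would be horizontal and the
      foot point itself would lie on the line at height \<open>k0\<close>, which carries no
      ramification point.\<close>
    have unram: "ev2 (pd2 f) (fst (y x1)) (snd (y x1)) \<noteq> 0" if "x1 \<in> X" for x1
    proof
      assume f2: "ev2 (pd2 f) (fst (y x1)) (snd (y x1)) = 0"
      note sys = lift[OF that]
      have "ev2 (pd1 f) (fst (y x1)) (snd (y x1)) \<noteq> 0"
        using sys f2 by (auto simp: offset_sys_def wpol_def)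
      moreover have "npol f (y x1) (x1, k0) = 0" using sys by (simp add: offset_sys_def)
      ultimately have "snd (y x1) = k0" using f2 by (simp add: npol_def)
      moreover have "ramification_pt f (y x1)"
        using sys f2 by (auto simp: ramification_pt_def curve_def offset_sys_def case_prod_beta)
      ultimately show False using no_ram by blast
    qed
    \<comment> \<open>With f2 nonzero the normal line is not horizontal, so it meets the line at
      height \<open>k0\<close> only once.\<close>
    have y_inj: "inj_on y X"
    proof (rule inj_onI)
      fix x x' assume x: "x \<in> X" "x' \<in> X" and eq: "y x = y x'"
      have "npol f (y x) (x, k0) = 0" "npol f (y x) (x', k0) = 0"
        using lift[OF x(1)] lift[OF x(2)] eq by (simp_all add: offset_sys_def)
      then have "ev2 (pd2 f) (fst (y x)) (snd (y x)) * (x - fst (y x))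
          = ev2 (pd2 f) (fst (y x)) (snd (y x)) * (x' - fst (y x))"
        by (simp add: npol_def)
      then show "x = x'" using unram[OF x(1)] by simp
    qed
    have ran: "e ` {..<deg_x1 g} = X" and e_inj: "inj_on e {..<deg_x1 g}"
      using e by (auto simp: bij_betw_def)
    show "\<exists>p q :: nat \<Rightarrow> complex \<times> complex. \<exists>u :: nat \<Rightarrow> complex.
          {(y, x, v). sys2 f d0 k0 y x v} = (\<lambda>i. (p i, q i, u i)) ` {..<deg_x1 g}
        \<and> inj_on q {..<deg_x1 g}
        \<and> line2 k0 \<inter> offset f d0 = q ` {..<deg_x1 g}
        \<and> inj_on p {..<deg_x1 g}
        \<and> (\<forall>i < deg_x1 g. regular_pt f (p i) \<and> \<not> ramification_pt f (p i))"
    proof (intro exI conjI)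
      have "{(z, x, u). sys2 f d0 k0 z x u} = (\<lambda>x1. (y x1, (x1, k0), v x1)) ` X"
        using lift unique by (fastforce simp: sys2_def)
      then show "{(z, x, u). sys2 f d0 k0 z x u}
          = (\<lambda>i. (y (e i), (e i, k0), v (e i))) ` {..<deg_x1 g}"
        unfolding ran[symmetric] by (simp add: image_image)
      show "inj_on (\<lambda>i. (e i, k0)) {..<deg_x1 g}" using e_inj by (auto simp: inj_on_def)
      have "line2 k0 \<inter> offset f d0 = (\<lambda>x1. (x1, k0)) ` X"
      proof
        show "line2 k0 \<inter> offset f d0 \<subseteq> (\<lambda>x1. (x1, k0)) ` X"
          using offset_subset_slice[OF g] by (auto simp: line2_def X_def)
        \<comment> \<open>Each root lifts to a solution, so it lies in the projection itself, before
          any closure.\<close>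
        have "(x1, k0) \<in> offset f d0" if "x1 \<in> X" for x1
          using lift[OF that] unfolding offset_def zclosure2_def by blast
        then show "(\<lambda>x1. (x1, k0)) ` X \<subseteq> line2 k0 \<inter> offset f d0" by (auto simp: line2_def)
      qed
      then show "line2 k0 \<inter> offset f d0 = (\<lambda>i. (e i, k0)) ` {..<deg_x1 g}"
        unfolding ran[symmetric] by (simp add: image_image)
      show "inj_on (\<lambda>i. y (e i)) {..<deg_x1 g}"
        using comp_inj_on[OF e_inj] y_inj ran by (simp add: comp_def)
      show "\<forall>i < deg_x1 g. regular_pt f (y (e i)) \<and> \<not> ramification_pt f (y (e i))"
      proof (intro allI impI)
        fix i assume "i < deg_x1 g"
        then have i: "e i \<in> X" using ran by auto
        have "y (e i) \<in> curve f"
          using lift[OF i] by (simp add: curve_def offset_sys_def case_prod_beta)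
        then show "regular_pt f (y (e i)) \<and> \<not> ramification_pt f (y (e i))"
          using unram[OF i] by (simp add: regular_pt_def ramification_pt_def)
      qed
    qed
  qed
  ultimately show ?thesis by blast
qed

end
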